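(* Let $q\in\mathbb{C}\setminus\{0\}$ be not a root of $1$, and consider $U_q(\mathfrak{sl}_2)$-symmetries on $\mathbb{C}_q[x^{\pm1},y^{\pm1}]$ with weight constants $\alpha,\beta$. There exist $4$ $U_q(\mathfrak{sl}_2)$-symmetries with $\alpha,\beta\in\{-1;1\}$, given by $$\pi(\mathsf k)(x)=\pm x,\qquad \pi(\mathsf k)(y)=\pm y,\qquad \pi(\mathsf e)(x)=\pi(\mathsf e)(y)=\pi(\mathsf f)(x)=\pi(\mathsf f)(y)=0$$ (the two signs being independent). These are all the symmetries with $\alpha,\beta\in\{-1;1\}$. They split into $2$ isomorphism classes: the first one is just the symmetry with $\alpha=\beta=1$, and the second one consists of the $3$ other symmetries.
   Context: $\mathbb{C}_q[x^{\pm1},y^{\pm1}]$ is the unital $\mathbb{C}$-algebra with generators $x,x^{-1},y,y^{-1}$ and relations $yx=qxy$, $xx^{-1}=x^{-1}x=yy^{-1}=y^{-1}y=\mathbf 1$. $U_q(\mathfrak{sl}_2)$ is the unital algebra with generators $\mathsf k,\mathsf k^{-1},\mathsf e,\mathsf f$ and relations $\mathsf k\mathsf k^{-1}=\mathsf k^{-1}\mathsf k=\mathbf 1$, $\mathsf{ke}=q^2\mathsf{ek}$, $\mathsf{kf}=q^{-2}\mathsf{fk}$, $\mathsf{ef}-\mathsf{fe}=\frac{\mathsf k-\mathsf k^{-1}}{q-q^{-1}}$, with Hopf structure $\Delta(\mathsf k)=\mathsf k\otimes\mathsf k$, $\Delta(\mathsf e)=\mathbf 1\otimes\mathsf e+\mathsf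 e\otimes\mathsf k$, $\Delta(\mathsf f)=\mathsf f\otimes\mathbf 1+\mathsf k^{-1}\otimes\mathsf f$, $\varepsilon(\mathsf k)=1$, $\varepsilon(\mathsf e)=\varepsilon(\mathsf f)=0$, $S(\mathsf k)=\mathsf k^{-1}$, $S(\mathsf e)=-\mathsf e\mathsf k^{-1}$, $S(\mathsf f)=-\mathsf{kf}$. A ($U_q(\mathfrak{sl}_2)$-)symmetry on $A=\mathbb{C}_q[x^{\pm1},y^{\pm1}]$ is an algebra homomorphism $\pi:U_q(\mathfrak{sl}_2)\to\operatorname{End}_{\mathbb C}A$ with $\pi(h)(ab)=\sum_{(h)}\pi(h_{(1)})(a)\pi(h_{(2)})(b)$ and $\pi(h)(\mathbf 1)=\varepsilon(h)\mathbf 1$. Symmetries $\pi_1,\pi_2$ are isomorphic if there is an algebra automorphism $\Psi$ of $A$ with $\Psi\pi_1(h)\Psi^{-1}=\pi_2(h)$ for all $h$. A symmetry is determined by the values of $\pi(\mathsf k),\pi(\mathsf e),\pi(\mathsf f)$ on $x,y$. If $\pi(\mathsf k)(x)=\alpha x$, $\pi(\mathsf k)(y)=\beta y$ with $\alpha,\beta\in\mathbb{C}\setminus\{0\}$, then $\alpha,\beta$ are called the weight constants of $\pi$. *)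

theory Defs
  imports
    Complex_Main
    "HOL-Library.Poly_Mapping"
    "HOL-Library.Product_Plus"
    "HOL-Library.FuncSet"
    "HOL-Algebra.QuotRing"
    "HOL-Algebra.Module"
begin

section \<open>Complex algebras\<close>

text \<open>
  A unital associative complex algebra is represented by a record of type
  \<^typ>\<open>(complex, 'a) module\<close>: a ring together with a scalar multiplication.
\<close>

definition alg_hom ::
  "(complex, 'a) module \<Rightarrow> (complex, 'b) module \<Rightarrow> ('a \<Rightarrow> 'b) set" where
  "alg_hom M N = {h \<in> ring_hom M N. \<forall>c. \<forall>x \<in> carrier M. h (c \<odot>\<^bsub>M\<^esub> x) = c \<odot>\<^bsub>N\<^esub> h x}"

definition alg_auto :: "(complex, 'a) module \<Rightarrow> ('a \<Rightarrow> 'a) set" where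
  "alg_auto M = {h \<in> alg_hom M M. bij_betw h (carrier M) (carrier M)}"

definition quot_alg :: "(complex, 'a) module \<Rightarrow> 'a set \<Rightarrow> (complex, 'a set) module" where
  "quot_alg M I =
     \<lparr>carrier = carrier (M Quot I), mult = mult (M Quot I), one = one (M Quot I),
      zero = zero (M Quot I), add = add (M Quot I),
      smult = (\<lambda>c X. \<Union>p\<in>X. I +>\<^bsub>M\<^esub> (c \<odot>\<^bsub>M\<^esub> p))\<rparr>"

text \<open>
  The algebra of linear endomorphisms of \<open>M\<close>. Its elements are extensional functions
  (\<^const>\<open>undefined\<close> outside the carrier), so that equality in it is equality on the
  carrier of \<open>M\<close>.
\<close>

definition end_alg :: "(complex, 'a) module \<Rightarrow> (complex, 'a \<Rightarrow> 'a) module" where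
  "end_alg M =
     \<lparr>carrier = {f \<in> carrier M \<rightarrow>\<^sub>E carrier M.
         (\<forall>x\<in>carrier M. \<forall>y\<in>carrier M. f (x \<oplus>\<^bsub>M\<^esub> y) = f x \<oplus>\<^bsub>M\<^esub> f y) \<and>
         (\<forall>c. \<forall>x\<in>carrier M. f (c \<odot>\<^bsub>M\<^esub> x) = c \<odot>\<^bsub>M\<^esub> f x)},
      mult = (\<lambda>f g. compose (carrier M) f g),
      one = (\<lambda>x\<in>carrier M. x),
      zero = (\<lambda>x\<in>carrier M. \<zero>\<^bsub>M\<^esub>),
      add = (\<lambda>f g. \<lambda>x\<in>carrier M. f x \<oplus>\<^bsub>M\<^esub> g x),
      smult = (\<lambda>c f. \<lambda>x\<in>carrier M. c \<odot>\<^bsub>M\<^esub> f x)\<rparr>"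


section \<open>Free algebras and presentations\<close>

text \<open>
  Words form a monoid under concatenation, written additively because the multiplication
  of \<^typ>\<open>'m \<Rightarrow>\<^sub>0 complex\<close> is the convolution product with respect to the additive monoid
  structure on \<^typ>\<open>'m\<close>. Thus \<^typ>\<open>'g list \<Rightarrow>\<^sub>0 complex\<close> is the free unital algebra on the
  generators \<^typ>\<open>'g\<close>, and \<^typ>\<open>('g list \<times> 'g list) \<Rightarrow>\<^sub>0 complex\<close> is its tensor square, the
  basis element \<open>(u, v)\<close> standing for \<open>u \<otimes> v\<close>.
\<close>

instantiation list :: (type) monoid_add
begin

definition zero_list :: "'a list" where
  "0 = []"

definition plus_list :: "'a list \<Rightarrow> 'a list \<Rightarrow> 'a list" where
  "xs + ys = xs @ ys"

instance
  by standard (simp_all add: zero_list_def plus_list_def)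

end

type_synonym 'g free = "'g list \<Rightarrow>\<^sub>0 complex"
type_synonym 'g free2 = "('g list \<times> 'g list) \<Rightarrow>\<^sub>0 complex"

abbreviation scalar :: "complex \<Rightarrow> ('m::monoid_add \<Rightarrow>\<^sub>0 complex)" where
  "scalar c \<equiv> Poly_Mapping.single 0 c"

definition monoid_alg :: "(complex, 'm::monoid_add \<Rightarrow>\<^sub>0 complex) module" where
  "monoid_alg =
     \<lparr>carrier = UNIV, mult = (*), one = 1, zero = 0, add = (+), smult = (\<lambda>c p. scalar c * p)\<rparr>"

definition word :: "'g list \<Rightarrow> 'g free" where
  "word w = Poly_Mapping.single w 1"

definition gen :: "'g \<Rightarrow> 'g free" where
  "gen g = word [g]"

text \<open>
  The multiplicative linear extension of a map \<open>\<phi>\<close> on generators to the free algebra;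
  \<open>\<eta>\<close> embeds the scalars into the target algebra.
\<close>

definition free_lift :: "(complex \<Rightarrow> 'r::ring_1) \<Rightarrow> ('g \<Rightarrow> 'r) \<Rightarrow> 'g free \<Rightarrow> 'r" where
  "free_lift \<eta> \<phi> p =
     (\<Sum>w\<in>Poly_Mapping.keys p. \<eta> (Poly_Mapping.lookup p w) * prod_list (map \<phi> w))"

definition tensor :: "'g free \<Rightarrow> 'g free \<Rightarrow> 'g free2" where
  "tensor p r =
     (\<Sum>u\<in>Poly_Mapping.keys p. \<Sum>v\<in>Poly_Mapping.keys r.
        Poly_Mapping.single (u, v) (Poly_Mapping.lookup p u * Poly_Mapping.lookup r v))"


section \<open>The quantum torus\<close>

datatype torus_gen = X | X' | Y | Y'

definition torus_rels :: "complex \<Rightarrow> torus_gen free set" where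
  "torus_rels q =
     {gen Y * gen X - scalar q * gen X * gen Y,
      gen X * gen X' - 1, gen X' * gen X - 1,
      gen Y * gen Y' - 1, gen Y' * gen Y - 1}"

definition torus_ideal :: "complex \<Rightarrow> torus_gen free set" where
  "torus_ideal q = Idl\<^bsub>monoid_alg\<^esub> (torus_rels q)"

definition torus :: "complex \<Rightarrow> (complex, torus_gen free set) module" where
  "torus q = quot_alg monoid_alg (torus_ideal q)"

definition torus_class :: "complex \<Rightarrow> torus_gen free \<Rightarrow> torus_gen free set" where
  "torus_class q p = torus_ideal q +>\<^bsub>monoid_alg\<^esub> p"

definition torus_x :: "complex \<Rightarrow> torus_gen free set" where
  "torus_x q = torus_class q (gen X)"

definition torus_y :: "complex \<Rightarrow> torus_gen free set" where
  "torus_y q = torus_class q (gen Y)"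


section \<open>The quantized enveloping algebra and its coalgebra structure\<close>

datatype uq_gen = K | K' | E | F

definition uq_rels :: "complex \<Rightarrow> uq_gen free set" where
  "uq_rels q =
     {gen K * gen K' - 1, gen K' * gen K - 1,
      gen K * gen E - scalar (q\<^sup>2) * gen E * gen K,
      gen K * gen F - scalar (inverse (q\<^sup>2)) * gen F * gen K,
      gen E * gen F - gen F * gen E - scalar (1 / (q - inverse q)) * (gen K - gen K')}"

definition uq_ideal :: "complex \<Rightarrow> uq_gen free set" where
  "uq_ideal q = Idl\<^bsub>monoid_alg\<^esub> (uq_rels q)"

definition uq :: "complex \<Rightarrow> (complex, uq_gen free set) module" where
  "uq q = quot_alg monoid_alg (uq_ideal q)"

definition uq_class :: "complex \<Rightarrow> uq_gen free \<Rightarrow> uq_gen free set" where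
  "uq_class q p = uq_ideal q +>\<^bsub>monoid_alg\<^esub> p"

definition uq_k :: "complex \<Rightarrow> uq_gen free set" where
  "uq_k q = uq_class q (gen K)"

definition uq_e :: "complex \<Rightarrow> uq_gen free set" where
  "uq_e q = uq_class q (gen E)"

definition uq_f :: "complex \<Rightarrow> uq_gen free set" where
  "uq_f q = uq_class q (gen F)"

text \<open>
  With \<open>T\<close> the free algebra and \<open>I\<close> the ideal of relations, the tensor square of \<open>T / I\<close> is
  \<open>(T \<otimes> T) / (I \<otimes> T + T \<otimes> I)\<close>; \<open>uq_ideal2\<close> is this denominator.
\<close>

definition uq_ideal2 :: "complex \<Rightarrow> uq_gen free2 set" where
  "uq_ideal2 q = Idl\<^bsub>monoid_alg\<^esub> {tensor p r | p r. p \<in> uq_ideal q \<or> r \<in> uq_ideal q}"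

definition uq2 :: "complex \<Rightarrow> (complex, uq_gen free2 set) module" where
  "uq2 q = quot_alg monoid_alg (uq_ideal2 q)"

fun comult_gen :: "uq_gen \<Rightarrow> uq_gen free2" where
  "comult_gen K = tensor (gen K) (gen K)"
| "comult_gen K' = tensor (gen K') (gen K')"
| "comult_gen E = tensor 1 (gen E) + tensor (gen E) (gen K)"
| "comult_gen F = tensor (gen F) 1 + tensor (gen K') (gen F)"

fun counit_gen :: "uq_gen \<Rightarrow> complex" where
  "counit_gen K = 1"
| "counit_gen K' = 1"
| "counit_gen E = 0"
| "counit_gen F = 0"

definition free_comult :: "uq_gen free \<Rightarrow> uq_gen free2" where
  "free_comult = free_lift scalar comult_gen"

definition free_counit :: "uq_gen free \<Rightarrow> complex" where
  "free_counit = free_lift (\<lambda>c. c) counit_gen"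

text \<open>
  The maps induced on the quotients; the argument is a coset of \<^const>\<open>uq_ideal\<close>, and
  the union in \<open>uq_comult\<close> is a single coset of \<^const>\<open>uq_ideal2\<close>.
\<close>

definition uq_comult :: "complex \<Rightarrow> uq_gen free set \<Rightarrow> uq_gen free2 set" where
  "uq_comult q h = (\<Union>p\<in>h. uq_ideal2 q +>\<^bsub>monoid_alg\<^esub> free_comult p)"

definition uq_counit :: "uq_gen free set \<Rightarrow> complex" where
  "uq_counit h = the_elem (free_counit ` h)"


text \<open>
  Well-definedness: \<open>uq_counit_class\<close> and \<open>uq_comult_class\<close> below show that the value on the
  class of \<open>p\<close> does not depend on the representative.
\<close>

lemma monoid_alg_simps [simp]:
  "carrier monoid_alg = UNIV" "mult monoid_alg = (*)" "one monoid_alg = 1"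
  "zero monoid_alg = 0" "add monoid_alg = (+)" "smult monoid_alg = (\<lambda>c p. scalar c * p)"
  by (simp_all add: monoid_alg_def)

lemma ring_monoid_alg: "ring (monoid_alg :: (complex, 'm::monoid_add \<Rightarrow>\<^sub>0 complex) module)"
proof (rule ringI)
  show "abelian_group (monoid_alg :: (complex, 'm \<Rightarrow>\<^sub>0 complex) module)"
  proof (rule abelian_groupI)
    fix x :: "'m \<Rightarrow>\<^sub>0 complex"
    show "\<exists>y\<in>carrier monoid_alg. y \<oplus>\<^bsub>monoid_alg\<^esub> x = \<zero>\<^bsub>monoid_alg\<^esub>"
      by (auto intro: exI[of _ "- x"])
  qed (auto simp: add_ac)
  show "Group.monoid (monoid_alg :: (complex, 'm \<Rightarrow>\<^sub>0 complex) module)"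
    by (rule monoidI) (auto simp: mult.assoc)
qed (auto simp: algebra_simps)

lemma monoid_alg_uminus:
  "\<ominus>\<^bsub>monoid_alg\<^esub> x = - (x :: 'm::monoid_add \<Rightarrow>\<^sub>0 complex)"
proof -
  interpret R: ring "monoid_alg :: (complex, 'm \<Rightarrow>\<^sub>0 complex) module" by (rule ring_monoid_alg)
  show ?thesis using R.minus_equality[of "- x" x] by simp
qed

lemma ideal_monoid_algI:
  fixes I :: "('m::monoid_add \<Rightarrow>\<^sub>0 complex) set"
  assumes "0 \<in> I" "\<And>x y. x \<in> I \<Longrightarrow> y \<in> I \<Longrightarrow> x + y \<in> I"
    "\<And>x y. x \<in> I \<Longrightarrow> y * x \<in> I" "\<And>x y. x \<in> I \<Longrightarrow> x * y \<in> I"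
  shows "ideal I monoid_alg"
proof (rule idealI[OF ring_monoid_alg])
  interpret R: ring "monoid_alg :: (complex, 'm \<Rightarrow>\<^sub>0 complex) module" by (rule ring_monoid_alg)
  have m: "- x \<in> I" if "x \<in> I" for x using assms(3)[OF that, of "-1"] by simp
  show "subgroup I (add_monoid monoid_alg)"
  proof (intro group.subgroupI[OF R.a_group])
    show "inv\<^bsub>add_monoid monoid_alg\<^esub> a \<in> I" if "a \<in> I" for a
      using m[OF that] monoid_alg_uminus[of a] unfolding a_inv_def by argo
  qed (use assms(1,2) in auto)
qed (use assms in auto)

lemma ideal_monoid_algD:
  fixes I :: "('m::monoid_add \<Rightarrow>\<^sub>0 complex) set"
  assumes "ideal I monoid_alg"
  shows "0 \<in> I" "\<And>x y. x \<in> I \<Longrightarrow> y \<in> I \<Longrightarrow> x + y \<in> I"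
    "\<And>x y. x \<in> I \<Longrightarrow> y * x \<in> I" "\<And>x y. x \<in> I \<Longrightarrow> x * y \<in> I"
    "\<And>x y. x \<in> I \<Longrightarrow> y \<in> I \<Longrightarrow> x - y \<in> I"
proof -
  interpret ideal I monoid_alg by fact
  show "0 \<in> I" using additive_subgroup.zero_closed[OF is_additive_subgroup] by simp
  show a: "\<And>x y. x \<in> I \<Longrightarrow> y \<in> I \<Longrightarrow> x + y \<in> I" using additive_subgroup.a_closed[OF is_additive_subgroup] by simp
  show b: "\<And>x y. x \<in> I \<Longrightarrow> y * x \<in> I" using I_l_closed by simp
  show "\<And>x y. x \<in> I \<Longrightarrow> x * y \<in> I" using I_r_closed by simp
  show "x - y \<in> I" if "x \<in> I" "y \<in> I" for x y
    using a[OF that(1) b[OF that(2), of "-1"]] by simp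
qed

lemma coset_eq_iff:
  fixes I :: "('m::monoid_add \<Rightarrow>\<^sub>0 complex) set"
  assumes "ideal I monoid_alg"
  shows "I +>\<^bsub>monoid_alg\<^esub> p = I +>\<^bsub>monoid_alg\<^esub> r \<longleftrightarrow> p - r \<in> I"
proof
  have e: "I +>\<^bsub>monoid_alg\<^esub> p = {i + p | i. i \<in> I}" for p :: "'m \<Rightarrow>\<^sub>0 complex"
    by (auto simp: a_r_coset_def r_coset_def)
  note d = ideal_monoid_algD[OF assms]
  show "p - r \<in> I" if "I +>\<^bsub>monoid_alg\<^esub> p = I +>\<^bsub>monoid_alg\<^esub> r"
  proof -
    have "p \<in> {i + r | i. i \<in> I}" using that d(1) unfolding e by force
    then show ?thesis by auto
  qed
  show "I +>\<^bsub>monoid_alg\<^esub> p = I +>\<^bsub>monoid_alg\<^esub> r" if pr: "p - r \<in> I"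
  proof -
    have "\<exists>j. i + p = j + r \<and> j \<in> I" if "i \<in> I" for i
      using d(2)[OF that pr] by (intro exI[of _ "i + (p - r)"]) simp
    moreover have "\<exists>j. i + r = j + p \<and> j \<in> I" if "i \<in> I" for i
      using d(5)[OF that pr] by (intro exI[of _ "i - (p - r)"]) simp
    ultimately show ?thesis unfolding e by blast
  qed
qed

lemma ideal_Idl: "ideal (Idl\<^bsub>monoid_alg\<^esub> S) (monoid_alg :: (complex, 'm::monoid_add \<Rightarrow>\<^sub>0 complex) module)"
  using ring.genideal_ideal[OF ring_monoid_alg] by simp

lemma Idl_self: "x \<in> S \<Longrightarrow> x \<in> Idl\<^bsub>monoid_alg\<^esub> (S :: ('m::monoid_add \<Rightarrow>\<^sub>0 complex) set)"
  using ring.genideal_self[OF ring_monoid_alg, of S] by auto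

lemma Idl_min: "ideal I monoid_alg \<Longrightarrow> S \<subseteq> I \<Longrightarrow> Idl\<^bsub>monoid_alg\<^esub> S \<subseteq> (I :: ('m::monoid_add \<Rightarrow>\<^sub>0 complex) set)"
  by (rule ring.genideal_minimal[OF ring_monoid_alg])

lemma pm_induct [case_names zero single add]:
  fixes p :: "'m \<Rightarrow>\<^sub>0 complex"
  assumes "P 0" "\<And>k c. P (Poly_Mapping.single k c)" "\<And>p r. P p \<Longrightarrow> P r \<Longrightarrow> P (p + r)"
  shows "P p"
proof (induct p rule: update_induct)
  case const then show ?case by (rule assms(1))
next
  case (update f a b)
  have "Poly_Mapping.update a b f = f + Poly_Mapping.single a b"
    using update(1) by (intro poly_mapping_eqI)
      (auto simp: lookup_update lookup_add lookup_single when_def in_keys_iff)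
  then show ?case using assms update by simp
qed

lemma free_lift_sup:
  assumes "\<eta> 0 = 0" "finite A" "Poly_Mapping.keys p \<subseteq> A"
  shows "free_lift \<eta> \<phi> p = (\<Sum>w\<in>A. \<eta> (Poly_Mapping.lookup p w) * prod_list (map \<phi> w))"
  unfolding free_lift_def
  by (rule sum.mono_neutral_left) (use assms in \<open>auto simp: in_keys_iff\<close>)

lemma free_lift_single:
  assumes "\<eta> 0 = 0"
  shows "free_lift \<eta> \<phi> (Poly_Mapping.single w c) = \<eta> c * prod_list (map \<phi> w)"
  using free_lift_sup[of \<eta> "{w}" "Poly_Mapping.single w c"] assms by simp

lemma free_lift_add:
  assumes "\<And>c d. \<eta> (c + d) = \<eta> c + \<eta> d"
  shows "free_lift \<eta> \<phi> (p + r) = free_lift \<eta> \<phi> p + free_lift \<eta> \<phi> r"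
proof -
  have z: "\<eta> 0 = 0" using assms[of 0 0] by simp
  let ?A = "Poly_Mapping.keys p \<union> Poly_Mapping.keys r"
  have *: "free_lift \<eta> \<phi> s = (\<Sum>w\<in>?A. \<eta> (Poly_Mapping.lookup s w) * prod_list (map \<phi> w))"
    if "Poly_Mapping.keys s \<subseteq> ?A" for s
    by (rule free_lift_sup) (use z that in auto)
  show ?thesis
    by (subst (1 2 3) *) (auto simp: keys_add lookup_add assms distrib_right sum.distrib
      dest!: subsetD[OF keys_add])
qed

lemma free_lift_mult:
  assumes add: "\<And>c d. \<eta> (c + d) = \<eta> c + \<eta> d" and mult: "\<And>c d. \<eta> (c * d) = \<eta> c * \<eta> d"
    and comm: "\<And>c x. \<eta> c * x = x * \<eta> c"
  shows "free_lift \<eta> \<phi> (p * r) = free_lift \<eta> \<phi> p * free_lift \<eta> \<phi> r"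
proof -
  have z: "\<eta> 0 = 0" using add[of 0 0] by simp
  note s = free_lift_single[of \<eta>, OF z]
  have z': "free_lift \<eta> \<phi> 0 = 0" by (simp add: free_lift_def)
  show ?thesis
  proof (induct p rule: pm_induct)
    case (single k c)
    show ?case
    proof (induct r rule: pm_induct)
      case (single l d)
      have "\<eta> d * prod_list (map \<phi> k) = prod_list (map \<phi> k) * \<eta> d" by (rule comm)
      then show ?case by (simp add: mult_single s plus_list_def mult mult.assoc)
        (metis mult.assoc)
    qed (auto simp: z' distrib_left free_lift_add[of \<eta>, OF add])
  qed (auto simp: z' distrib_right free_lift_add[of \<eta>, OF add])
qed

lemma scalar_comm: "scalar c * x = x * (scalar c :: 'm::monoid_add \<Rightarrow>\<^sub>0 complex)"
  by (induct x rule: pm_induct) (auto simp: mult_single algebra_simps)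

lemma free_comult_hom:
  "free_comult (p + r) = free_comult p + free_comult r"
  "free_comult (p * r) = free_comult p * free_comult r"
  "free_comult 1 = 1" "free_comult 0 = 0" "free_comult (scalar c) = scalar c"
  "free_comult (p - r) = free_comult p - free_comult r"
  "free_comult (gen g) = comult_gen g"
proof -
  show a: "free_comult (p + r) = free_comult p + free_comult r" for p r
    unfolding free_comult_def by (rule free_lift_add) (simp add: single_add)
  show "free_comult (p * r) = free_comult p * free_comult r"
    unfolding free_comult_def by (rule free_lift_mult) (auto simp: single_add mult_single scalar_comm)
  show s: "free_comult (scalar c) = scalar c" for c
    unfolding free_comult_def by (subst free_lift_single) (auto simp: zero_list_def)
  from s[of 1] show "free_comult 1 = 1" by simp
  from s[of 0] show "free_comult 0 = 0" by simp
  show "free_comult (p - r) = free_comult p - free_comult r" using a[of "p - r" r] by simp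
  show "free_comult (gen g) = comult_gen g"
    unfolding free_comult_def gen_def word_def by (subst free_lift_single) auto
qed

lemma free_counit_hom:
  "free_counit (p + r) = free_counit p + free_counit r"
  "free_counit (p * r) = free_counit p * free_counit r"
  "free_counit 1 = 1" "free_counit 0 = 0" "free_counit (scalar c) = c"
  "free_counit (p - r) = free_counit p - free_counit r"
  "free_counit (gen g) = counit_gen g"
proof -
  show a: "free_counit (p + r) = free_counit p + free_counit r" for p r
    unfolding free_counit_def by (rule free_lift_add) simp
  show "free_counit (p * r) = free_counit p * free_counit r"
    unfolding free_counit_def by (rule free_lift_mult) auto
  show s: "free_counit (scalar c) = c" for c
    unfolding free_counit_def by (subst free_lift_single) (auto simp: zero_list_def)
  from s[of 1] show "free_counit 1 = 1" by simp
  from s[of 0] show "free_counit 0 = 0" by simp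
  show "free_counit (p - r) = free_counit p - free_counit r" using a[of "p - r" r] by simp
  show "free_counit (gen g) = counit_gen g"
    unfolding free_counit_def gen_def word_def by (subst free_lift_single) auto
qed

lemma uq_counit_class: "uq_counit (uq_class q p) = free_counit p"
proof -
  have i: "ideal {p. free_counit p = 0} monoid_alg"
    by (rule ideal_monoid_algI) (auto simp: free_counit_hom)
  have "uq_ideal q \<subseteq> {p. free_counit p = 0}"
    unfolding uq_ideal_def by (rule Idl_min[OF i]) (auto simp: uq_rels_def free_counit_hom)
  moreover have "0 \<in> uq_ideal q" unfolding uq_ideal_def by (rule ideal_monoid_algD[OF ideal_Idl])
  ultimately have "free_counit ` uq_class q p = {free_counit p}"
    by (force simp: uq_class_def a_r_coset_def r_coset_def free_counit_hom)
  then show ?thesis by (simp add: uq_counit_def)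
qed

lemma tensor_sup:
  assumes "finite A" "Poly_Mapping.keys p \<subseteq> A" "finite B" "Poly_Mapping.keys r \<subseteq> B"
  shows "tensor p r = (\<Sum>u\<in>A. \<Sum>v\<in>B.
    Poly_Mapping.single (u, v) (Poly_Mapping.lookup p u * Poly_Mapping.lookup r v))"
proof -
  have "tensor p r = (\<Sum>u\<in>Poly_Mapping.keys p. \<Sum>v\<in>B.
    Poly_Mapping.single (u, v) (Poly_Mapping.lookup p u * Poly_Mapping.lookup r v))"
    unfolding tensor_def
    by (intro sum.cong refl sum.mono_neutral_left) (use assms in \<open>auto simp: in_keys_iff\<close>)
  also have "\<dots> = (\<Sum>u\<in>A. \<Sum>v\<in>B.
    Poly_Mapping.single (u, v) (Poly_Mapping.lookup p u * Poly_Mapping.lookup r v))"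
    by (intro sum.mono_neutral_left) (use assms in \<open>auto simp: in_keys_iff\<close>)
  finally show ?thesis .
qed

lemma tensor_add:
  "tensor (p + p') r = tensor p r + tensor p' r"
  "tensor p (r + r') = tensor p r + tensor p r'"
proof -
  let ?A = "Poly_Mapping.keys p \<union> Poly_Mapping.keys p'"
  have *: "tensor s r = (\<Sum>u\<in>?A. \<Sum>v\<in>Poly_Mapping.keys r.
    Poly_Mapping.single (u, v) (Poly_Mapping.lookup s u * Poly_Mapping.lookup r v))"
    if "Poly_Mapping.keys s \<subseteq> ?A" for s using that by (intro tensor_sup) auto
  show "tensor (p + p') r = tensor p r + tensor p' r"
    by (subst (1 2 3) *) (auto simp: lookup_add single_add distrib_right sum.distrib
      dest!: subsetD[OF keys_add])
  let ?B = "Poly_Mapping.keys r \<union> Poly_Mapping.keys r'"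
  have *: "tensor p s = (\<Sum>u\<in>Poly_Mapping.keys p. \<Sum>v\<in>?B.
    Poly_Mapping.single (u, v) (Poly_Mapping.lookup p u * Poly_Mapping.lookup s v))"
    if "Poly_Mapping.keys s \<subseteq> ?B" for s using that by (intro tensor_sup) auto
  show "tensor p (r + r') = tensor p r + tensor p r'"
    by (subst (1 2 3) *) (auto simp: lookup_add single_add distrib_left sum.distrib
      dest!: subsetD[OF keys_add])
qed

lemma tensor_0 [simp]: "tensor 0 r = 0" "tensor p 0 = 0"
  by (simp_all add: tensor_def)

lemma tensor_single:
  "tensor (Poly_Mapping.single u c) (Poly_Mapping.single v d) = Poly_Mapping.single (u, v) (c * d)"
  by (subst tensor_sup[of "{u}" _ "{v}"]) auto

lemma tensor_diff:
  "tensor (p - p') r = tensor p r - tensor p' r"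
  "tensor p (r - r') = tensor p r - tensor p r'"
  using tensor_add(1)[of "p - p'" p' r] tensor_add(2)[of p "r - r'" r']
  by (simp_all add: eq_diff_eq)

lemma tensor_mult: "tensor p r * tensor p' r' = tensor (p * p') (r * r')"
proof (induct p rule: pm_induct)
  case (single k c) show ?case
  proof (induct r rule: pm_induct)
    case (single l d) show ?case
    proof (induct p' rule: pm_induct)
      case (single k' c') show ?case
        by (induct r' rule: pm_induct) (auto simp: tensor_single mult_single tensor_add distrib_left mult_ac)
    qed (auto simp: tensor_add algebra_simps)
  qed (auto simp: tensor_add algebra_simps)
qed (auto simp: tensor_add algebra_simps)

lemma tensor_scalar:
  "tensor (scalar c * p) r = scalar c * tensor p r" "tensor p (scalar c * r) = scalar c * tensor p r"
proof -
  have 1: "tensor (scalar c) 1 = scalar c" "tensor 1 (scalar c) = scalar c"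
    by (simp_all add: tensor_single single_one[symmetric] del: single_one)
       (simp_all add: zero_prod_def)
  show "tensor (scalar c * p) r = scalar c * tensor p r"
    using tensor_mult[of "scalar c" 1 p r] unfolding 1 by simp
  show "tensor p (scalar c * r) = scalar c * tensor p r"
    using tensor_mult[of 1 "scalar c" p r] unfolding 1 by simp
qed

lemma tensor_1: "tensor 1 1 = 1"
  by (simp add: tensor_single single_one[symmetric] del: single_one) (simp add: zero_prod_def)

lemma tensor_ideal2:
  "r \<in> uq_ideal q \<Longrightarrow> tensor p r \<in> uq_ideal2 q" "p \<in> uq_ideal q \<Longrightarrow> tensor p r \<in> uq_ideal2 q"
  unfolding uq_ideal2_def by (rule Idl_self, blast)+

lemma free_comult_ideal:
  assumes "q \<noteq> 0" "p \<in> uq_ideal q"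
  shows "free_comult p \<in> uq_ideal2 q"
proof -
  have J: "ideal (uq_ideal2 q) monoid_alg" unfolding uq_ideal2_def by (rule ideal_Idl)
  note D = ideal_monoid_algD[OF J]
  have I: "ideal {p. free_comult p \<in> uq_ideal2 q} monoid_alg"
    by (rule ideal_monoid_algI) (auto simp: free_comult_hom D)
  have R: "x \<in> uq_ideal q" if "x \<in> uq_rels q" for x
    unfolding uq_ideal_def by (rule Idl_self[OF that])
  let ?k = "gen K" and ?l = "gen K'" and ?e = "gen E" and ?f = "gen F"
  let ?d = "scalar (1 / (q - inverse q)) :: uq_gen free"
  let ?d2 = "scalar (1 / (q - inverse q)) :: uq_gen free2"
  let ?rl = "?k * ?l - 1" and ?rl' = "?l * ?k - 1"
  let ?re = "?k * ?e - scalar (q\<^sup>2) * ?e * ?k"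
  let ?rf = "?k * ?f - scalar (inverse (q\<^sup>2)) * ?f * ?k"
  let ?r = "?e * ?f - ?f * ?e - ?d * (?k - ?l)"
  have r: "?rl \<in> uq_ideal q" "?rl' \<in> uq_ideal q" "?re \<in> uq_ideal q" "?rf \<in> uq_ideal q" "?r \<in> uq_ideal q"
    by (rule R, simp add: uq_rels_def)+
  note S = tensor_mult tensor_diff tensor_add tensor_scalar algebra_simps
  note T = tensor_ideal2
  have "free_comult ?rl = tensor ?rl (?k * ?l) + tensor 1 ?rl"
    by (simp add: free_comult_hom tensor_1[symmetric] S)
  then have 1: "free_comult ?rl \<in> uq_ideal2 q" by (simp add: D(2) T r)
  have "free_comult ?rl' = tensor ?rl' (?l * ?k) + tensor 1 ?rl'"
    by (simp add: free_comult_hom tensor_1[symmetric] S)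
  then have 2: "free_comult ?rl' \<in> uq_ideal2 q" by (simp add: D(2) T r)
  have "free_comult ?re = tensor ?k ?re + tensor ?re (?k * ?k)"
    by (simp add: free_comult_hom S)
  then have 3: "free_comult ?re \<in> uq_ideal2 q" by (simp add: D(2) T r)
  have "free_comult ?rf = tensor ?rf ?k + tensor (?k * ?l) ?rf +
     scalar (inverse (q\<^sup>2)) * tensor (?k * ?l - ?l * ?k) (?f * ?k)"
    by (simp add: free_comult_hom S)
  moreover have "?k * ?l - ?l * ?k \<in> uq_ideal q"
    using ideal_monoid_algD(5)[OF ideal_Idl, of ?rl "uq_rels q" ?rl'] r
    by (simp add: uq_ideal_def)
  ultimately have 4: "free_comult ?rf \<in> uq_ideal2 q" by (simp add: D(2,3) T r)
  have i: "ideal (uq_ideal q) monoid_alg" unfolding uq_ideal_def by (rule ideal_Idl)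
  note Di = ideal_monoid_algD[OF i]
  have le: "scalar (q\<^sup>2) * (?l * ?e - scalar (inverse (q\<^sup>2)) * ?e * ?l) \<in> uq_ideal q"
  proof -
    have "?l * ?re * ?l \<in> uq_ideal q" by (intro Di r)
    moreover have "?rl' * ?e * ?l \<in> uq_ideal q" "scalar (q\<^sup>2) * (?l * ?e * ?rl) \<in> uq_ideal q"
      by (intro Di r)+
    ultimately have "?rl' * ?e * ?l - ?l * ?re * ?l - scalar (q\<^sup>2) * (?l * ?e * ?rl) \<in> uq_ideal q"
      by (intro Di(5))
    moreover have "scalar (q\<^sup>2) * scalar (inverse (q\<^sup>2)) = (1 :: uq_gen free)"
      using assms by (simp add: mult_single)
    moreover have "?l * (scalar (q\<^sup>2) * x) = scalar (q\<^sup>2) * (?l * x)" for x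
      by (metis mult.assoc scalar_comm)
    ultimately show ?thesis
      by (simp add: algebra_simps flip: mult.assoc)
  qed
  have "scalar (inverse (q\<^sup>2)) * (scalar (q\<^sup>2) * (?l * ?e - scalar (inverse (q\<^sup>2)) * ?e * ?l)) \<in> uq_ideal q"
    by (intro Di le)
  then have le': "?l * ?e - scalar (inverse (q\<^sup>2)) * ?e * ?l \<in> uq_ideal q"
    using assms by (simp add: mult_single flip: mult.assoc)
  have "free_comult ?r = tensor ?l ?r + tensor ?r ?k
     + tensor (?e * ?l) ?rf - tensor (?l * ?e - scalar (inverse (q\<^sup>2)) * ?e * ?l) (?f * ?k)
     + (tensor (?l * ?e) (?f * ?k) - tensor (?l * ?e) (?f * ?k))"
    by (simp add: free_comult_hom S)
  then have "free_comult ?r \<in> uq_ideal2 q"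
    using D(5)[OF D(2)[OF D(2)[OF T(1)[OF r(5), of ?l] T(2)[OF r(5), of ?k]] T(1)[OF r(4), of "?e * ?l"]]
       T(2)[OF le', of "?f * ?k"]]
    by simp
  with 1 2 3 4 have "uq_rels q \<subseteq> {p. free_comult p \<in> uq_ideal2 q}"
    by (auto simp: uq_rels_def)
  from Idl_min[OF I this] assms(2) show ?thesis by (auto simp: uq_ideal_def)
qed

lemma uq_comult_class:
  assumes "q \<noteq> 0"
  shows "uq_comult q (uq_class q p) = uq_ideal2 q +>\<^bsub>monoid_alg\<^esub> free_comult p"
proof -
  have J: "ideal (uq_ideal2 q) monoid_alg" unfolding uq_ideal2_def by (rule ideal_Idl)
  have i: "0 \<in> uq_ideal q" unfolding uq_ideal_def by (rule ideal_monoid_algD[OF ideal_Idl])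
  have "uq_ideal2 q +>\<^bsub>monoid_alg\<^esub> free_comult s = uq_ideal2 q +>\<^bsub>monoid_alg\<^esub> free_comult p"
    if "s \<in> uq_class q p" for s
  proof -
    from that obtain j where "j \<in> uq_ideal q" "s = j + p"
      by (auto simp: uq_class_def a_r_coset_def r_coset_def)
    then show ?thesis using coset_eq_iff[OF J] free_comult_ideal[OF assms]
      by (simp add: free_comult_hom)
  qed
  moreover have "p \<in> uq_class q p" using i by (force simp: uq_class_def a_r_coset_def r_coset_def)
  ultimately show ?thesis unfolding uq_comult_def by blast
qed


section \<open>Symmetries\<close>

text \<open>
  The Sweedler sum \<open>\<Sum> \<pi>(h1)(a) \<pi>(h2)(b)\<close> for \<open>t\<close> representing \<open>\<Sum> h1 \<otimes> h2\<close>.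
\<close>

definition tensor_act ::
  "complex \<Rightarrow> (uq_gen free set \<Rightarrow> torus_gen free set \<Rightarrow> torus_gen free set) \<Rightarrow>
   uq_gen free2 \<Rightarrow> torus_gen free set \<Rightarrow> torus_gen free set \<Rightarrow> torus_gen free set" where
  "tensor_act q \<pi> t a b =
     (\<Oplus>\<^bsub>torus q\<^esub> z\<in>Poly_Mapping.keys t.
        Poly_Mapping.lookup t z \<odot>\<^bsub>torus q\<^esub>
          (\<pi> (uq_class q (word (fst z))) a \<otimes>\<^bsub>torus q\<^esub> \<pi> (uq_class q (word (snd z))) b))"

text \<open>
  Extensionality of \<open>\<pi>\<close> makes a symmetry determined by its values on the carrier of
  \<^const>\<open>uq\<close>, so that symmetries can be counted.
\<close>

definition symmetry ::
  "complex \<Rightarrow> (uq_gen free set \<Rightarrow> torus_gen free set \<Rightarrow> torus_gen free set) \<Rightarrow> bool" where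
  "symmetry q \<pi> \<longleftrightarrow>
     \<pi> \<in> alg_hom (uq q) (end_alg (torus q)) \<and>
     \<pi> \<in> extensional (carrier (uq q)) \<and>
     (\<forall>h\<in>carrier (uq q). \<forall>a\<in>carrier (torus q). \<forall>b\<in>carrier (torus q). \<forall>t\<in>uq_comult q h.
        \<pi> h (a \<otimes>\<^bsub>torus q\<^esub> b) = tensor_act q \<pi> t a b) \<and>
     (\<forall>h\<in>carrier (uq q). \<pi> h \<one>\<^bsub>torus q\<^esub> = uq_counit h \<odot>\<^bsub>torus q\<^esub> \<one>\<^bsub>torus q\<^esub>)"

definition symmetry_iso ::
  "complex \<Rightarrow> ((uq_gen free set \<Rightarrow> torus_gen free set \<Rightarrow> torus_gen free set) \<times>
    (uq_gen free set \<Rightarrow> torus_gen free set \<Rightarrow> torus_gen free set)) set" where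
  "symmetry_iso q =
     {(\<pi>\<^sub>1, \<pi>\<^sub>2). symmetry q \<pi>\<^sub>1 \<and> symmetry q \<pi>\<^sub>2 \<and>
        (\<exists>\<Psi>\<in>alg_auto (torus q). \<forall>h\<in>carrier (uq q). \<forall>a\<in>carrier (torus q).
           \<Psi> (\<pi>\<^sub>1 h (inv_into (carrier (torus q)) \<Psi> a)) = \<pi>\<^sub>2 h a)}"

definition weight_constants ::
  "complex \<Rightarrow> (uq_gen free set \<Rightarrow> torus_gen free set \<Rightarrow> torus_gen free set) \<Rightarrow>
   complex \<Rightarrow> complex \<Rightarrow> bool" where
  "weight_constants q \<pi> \<alpha> \<beta> \<longleftrightarrow> \<alpha> \<noteq> 0 \<and> \<beta> \<noteq> 0 \<and>
     \<pi> (uq_k q) (torus_x q) = \<alpha> \<odot>\<^bsub>torus q\<^esub> torus_x q \<and>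
     \<pi> (uq_k q) (torus_y q) = \<beta> \<odot>\<^bsub>torus q\<^esub> torus_y q"

definition sign_symmetries ::
  "complex \<Rightarrow> (uq_gen free set \<Rightarrow> torus_gen free set \<Rightarrow> torus_gen free set) set" where
  "sign_symmetries q =
     {\<pi>. symmetry q \<pi> \<and> (\<exists>\<alpha>\<in>{-1, 1}. \<exists>\<beta>\<in>{-1, 1}. weight_constants q \<pi> \<alpha> \<beta>)}"

end

theory Submission
  imports Defs "HOL-Library.Product_Lexorder"
begin

text \<open>
  Write \<open>A\<close> for the quantum torus. Let \<open>\<pi>\<close> be a symmetry whose weights are signs. Since \<open>k\<close> is
  grouplike, \<open>\<pi>(k)\<close> is an algebra endomorphism of \<open>A\<close>, and \<open>\<pi>(k)\<^sup>2\<close> fixes \<open>x\<close> and \<open>y\<close>, so it is the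
  identity. From \<open>k e = q\<^sup>2 e k\<close> one gets \<open>\<pi>(e) = \<pi>(k)\<^sup>2 \<pi>(e) = q\<^sup>4 \<pi>(e) \<pi>(k)\<^sup>2 = q\<^sup>4 \<pi>(e)\<close>, hence
  \<open>\<pi>(e) = 0\<close>, and likewise \<open>\<pi>(f) = 0\<close>. Therefore the two weights determine \<open>\<pi>\<close>
  (\<open>sign_weights_unique\<close>).

  Existence comes from the two one-dimensional characters \<open>\<chi>\<^sub>\<epsilon>\<close> of \<open>U\<^sub>q(sl\<^sub>2)\<close>, for \<open>\<epsilon>\<close> a sign,
  given by \<open>k \<mapsto> \<epsilon>\<close> and \<open>e, f \<mapsto> 0\<close>. The involution \<open>\<sigma>: x \<mapsto> \<alpha> x, y \<mapsto> \<beta> y\<close> splits \<open>A\<close> into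
  eigenspaces \<open>A\<^sub>1\<close> and \<open>A\<^sub>-\<^sub>1\<close>; let \<open>h\<close> act on \<open>A\<^sub>\<epsilon>\<close> as the scalar \<open>\<chi>\<^sub>\<epsilon>(h)\<close>. The product of
  \<open>A\<^sub>\<epsilon>\<close> and \<open>A\<^sub>\<delta>\<close> lies in the eigenspace for \<open>\<epsilon>\<delta>\<close>, and \<open>\<chi>\<^sub>\<epsilon> \<otimes> \<chi>\<^sub>\<delta>\<close> composed with the
  comultiplication is \<open>\<chi>\<close> at \<open>\<epsilon>\<delta>\<close>, which is exactly the compatibility required
  of a symmetry (\<open>symmetry_sign_symmetry\<close>).

  The automorphism \<open>x \<mapsto> y, y \<mapsto> x\<^sup>-\<^sup>1 y\<^sup>-\<^sup>1\<close> has order three and turns the weights \<open>(\<alpha>, \<beta>)\<close> into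
  \<open>(\<alpha>\<beta>, \<alpha>)\<close>, so it permutes the three nontrivial symmetries cyclically. An isomorphism
  conjugates \<open>\<pi>(k)\<close>, so the symmetry with \<open>\<pi>(k) = 1\<close> is isomorphic to none of them.

  A class of the isomorphism relation contains, a priori, symmetries that are not
  diagonal on \<open>x\<close> and \<open>y\<close>. To exclude these one needs that every unit of \<open>A\<close> is a scalar times
  a monomial \<open>x\<^sup>i y\<^sup>j\<close>: then every unit is an eigenvector of each \<open>\<sigma>\<close>, units are carried to
  units, and so the conjugate of \<open>\<sigma>\<close> is diagonal again
  (\<open>symmetry_iso_sign_weights\<close>). The statement on units follows from
  the linear independence of the monomials (\<open>torus_class_eq_iff_normal_form\<close>, which also shows
  that the four symmetries are different) by comparing leading and trailing terms
  (\<open>twisted_mult_eq_single\<close>).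
\<close>

section \<open>Quotients of monoid algebras\<close>

abbreviation coset :: "('m::monoid_add \<Rightarrow>\<^sub>0 complex) set \<Rightarrow> ('m \<Rightarrow>\<^sub>0 complex) \<Rightarrow> ('m \<Rightarrow>\<^sub>0 complex) set"
  where "coset I p \<equiv> I +>\<^bsub>monoid_alg\<^esub> p"

text \<open>
  These equations turn every computation in a quotient algebra into one with representatives
  in a monoid algebra, where type-class arithmetic applies.
\<close>

lemma quot_alg_simps:
  assumes I: "ideal I monoid_alg"
  shows "carrier (quot_alg monoid_alg I) = range (coset I)"
    and "coset I p \<otimes>\<^bsub>quot_alg monoid_alg I\<^esub> coset I r = coset I (p * r)"
    and "coset I p \<oplus>\<^bsub>quot_alg monoid_alg I\<^esub> coset I r = coset I (p + r)"
    and "\<one>\<^bsub>quot_alg monoid_alg I\<^esub> = coset I 1"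
    and "\<zero>\<^bsub>quot_alg monoid_alg I\<^esub> = coset I 0"
    and "c \<odot>\<^bsub>quot_alg monoid_alg I\<^esub> coset I p = coset I (scalar c * p)"
proof -
  interpret ideal I monoid_alg by (rule I)
  show "carrier (quot_alg monoid_alg I) = range (coset I)"
    by (auto simp: quot_alg_def FactRing_def A_RCOSETS_def' )
  show "coset I p \<otimes>\<^bsub>quot_alg monoid_alg I\<^esub> coset I r = coset I (p * r)"
    using rcoset_mult_add[of p r] by (simp add: quot_alg_def FactRing_def)
  show "coset I p \<oplus>\<^bsub>quot_alg monoid_alg I\<^esub> coset I r = coset I (p + r)"
    using a_rcos_sum[of p r] by (simp add: quot_alg_def FactRing_def)
  show "\<one>\<^bsub>quot_alg monoid_alg I\<^esub> = coset I 1" by (simp add: quot_alg_def FactRing_def)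
  show "\<zero>\<^bsub>quot_alg monoid_alg I\<^esub> = coset I 0"
    by (auto simp: quot_alg_def FactRing_def a_r_coset_def r_coset_def)
  have eq: "coset I (scalar c * s) = coset I (scalar c * p)" if "s \<in> coset I p" for s
  proof -
    from that obtain j where j: "j \<in> I" "s = j + p" by (auto simp: a_r_coset_def r_coset_def)
    have "scalar c * s - scalar c * p = scalar c * j" by (simp add: j(2) distrib_left)
    then show ?thesis
      using ideal_monoid_algD(3)[OF I j(1), of "scalar c"] coset_eq_iff[OF I] by metis
  qed
  have mem: "p \<in> coset I p"
    using ideal_monoid_algD(1)[OF I] by (force simp: a_r_coset_def r_coset_def)
  have "c \<odot>\<^bsub>quot_alg monoid_alg I\<^esub> coset I p = (\<Union>s\<in>coset I p. coset I (scalar c * s))"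
    by (simp add: quot_alg_def)
  also have "\<dots> = (\<Union>s\<in>coset I p. coset I (scalar c * p))"
    by (rule SUP_cong[OF refl eq])
  also have "\<dots> = coset I (scalar c * p)"
    by (rule UN_constant_eq[OF mem]) simp
  finally show "c \<odot>\<^bsub>quot_alg monoid_alg I\<^esub> coset I p = coset I (scalar c * p)" .
qed

lemma coset_self: "ideal I monoid_alg \<Longrightarrow> p \<in> coset I p"
  using ideal_monoid_algD(1) by (force simp: a_r_coset_def r_coset_def)

lemma ring_quot_alg:
  assumes I: "ideal I monoid_alg"
  shows "ring (quot_alg monoid_alg I)"
proof (rule ringI)
  note [simp] = quot_alg_simps[OF I]
  show "abelian_group (quot_alg monoid_alg I)"
  proof (rule abelian_groupI)
    fix x assume "x \<in> carrier (quot_alg monoid_alg I)"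
    then obtain p where "x = coset I p" by auto
    then have "coset I (- p) \<oplus>\<^bsub>quot_alg monoid_alg I\<^esub> x = \<zero>\<^bsub>quot_alg monoid_alg I\<^esub>" by simp
    then show "\<exists>y\<in>carrier (quot_alg monoid_alg I).
        y \<oplus>\<^bsub>quot_alg monoid_alg I\<^esub> x = \<zero>\<^bsub>quot_alg monoid_alg I\<^esub>" by auto
  qed (auto simp: add_ac)
  show "Group.monoid (quot_alg monoid_alg I)"
    by (rule monoidI) (auto simp: mult.assoc)
qed (auto simp: quot_alg_simps[OF I] algebra_simps)

lemma finsum_coset:
  assumes I: "ideal I monoid_alg" and "finite A"
  shows "(\<Oplus>\<^bsub>quot_alg monoid_alg I\<^esub> z\<in>A. coset I (f z)) = coset I (sum f A)"
proof -
  interpret ring "quot_alg monoid_alg I" by (rule ring_quot_alg[OF I])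
  show ?thesis using assms(2)
    by induct (auto simp: quot_alg_simps[OF I] finsum_insert)
qed

lemma coset_mult_cong:
  assumes I: "ideal I monoid_alg" and "coset I a = coset I a'" "coset I b = coset I b'"
  shows "coset I (a * b) = coset I (a' * b')"
  using assms(2,3) quot_alg_simps(2)[OF I] by metis

text \<open>
  The generators generate, so a property of their classes that is stable under the algebra
  operations holds throughout. The closure conditions are stated inside the quotient so that
  they can be fed with the homomorphism laws of a map defined on it.
\<close>

lemma quot_free_induct [consumes 2, case_names gen smult one add mult]:
  fixes I :: "'g free set"
  assumes I: "ideal I monoid_alg" and h: "h \<in> carrier (quot_alg monoid_alg I)"
    and gen: "\<And>g. P (coset I (gen g))"
    and smult: "\<And>c a. a \<in> carrier (quot_alg monoid_alg I) \<Longrightarrow> P a \<Longrightarrow> P (c \<odot>\<^bsub>quot_alg monoid_alg I\<^esub> a)"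
    and one: "P \<one>\<^bsub>quot_alg monoid_alg I\<^esub>"
    and add: "\<And>a b. a \<in> carrier (quot_alg monoid_alg I) \<Longrightarrow> b \<in> carrier (quot_alg monoid_alg I) \<Longrightarrow>
      P a \<Longrightarrow> P b \<Longrightarrow> P (a \<oplus>\<^bsub>quot_alg monoid_alg I\<^esub> b)"
    and mult: "\<And>a b. a \<in> carrier (quot_alg monoid_alg I) \<Longrightarrow> b \<in> carrier (quot_alg monoid_alg I) \<Longrightarrow>
      P a \<Longrightarrow> P b \<Longrightarrow> P (a \<otimes>\<^bsub>quot_alg monoid_alg I\<^esub> b)"
  shows "P h"
proof -
  note s = quot_alg_simps[OF I]
  have w: "P (coset I (word w))" for w
  proof (induct w)
    case Nil then show ?case using one by (simp add: s word_def flip: zero_list_def)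
  next
    case (Cons g w)
    then have "P (coset I (gen g * word w))" using mult[of "coset I (gen g)" "coset I (word w)"] gen
      by (simp add: s)
    then show ?case by (simp add: gen_def word_def mult_single plus_list_def)
  qed
  have m: "P (coset I (Poly_Mapping.single w c))" for w c
    using smult[of "coset I (word w)" c] w[of w]
    by (simp add: s word_def mult_single)
  have "P (coset I p)" for p
  proof (induct p rule: pm_induct)
    case zero show ?case using m[of _ 0] by simp
  next
    case (add p r)
    then show ?case using assms(6)[of "coset I p" "coset I r"] by (simp add: s)
  qed (rule m)
  then show ?thesis using h by (auto simp: s)
qed

lemma quot_free_hom_eqI:
  fixes I :: "'g free set"
  assumes I: "ideal I monoid_alg"
    and f: "f \<in> alg_hom (quot_alg monoid_alg I) M" and f': "f' \<in> alg_hom (quot_alg monoid_alg I) M"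
    and "\<And>g. f (coset I (gen g)) = f' (coset I (gen g))"
    and "a \<in> carrier (quot_alg monoid_alg I)"
  shows "f a = f' a"
  using I assms(5)
  by (induct rule: quot_free_induct)
    (use assms(4) f f' in \<open>auto simp: alg_hom_def ring_hom_add ring_hom_mult ring_hom_one\<close>)

abbreviation free_subst :: "('g \<Rightarrow> 'h free) \<Rightarrow> 'g free \<Rightarrow> 'h free" where
  "free_subst \<equiv> free_lift scalar"

lemma free_subst_hom:
  "free_subst \<phi> (p + r) = free_subst \<phi> p + free_subst \<phi> r"
  "free_subst \<phi> (p * r) = free_subst \<phi> p * free_subst \<phi> r"
  "free_subst \<phi> 1 = 1" "free_subst \<phi> 0 = 0" "free_subst \<phi> (scalar c) = scalar c"
  "free_subst \<phi> (p - r) = free_subst \<phi> p - free_subst \<phi> r"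
  "free_subst \<phi> (gen g) = \<phi> g"
proof -
  show a: "free_subst \<phi> (p + r) = free_subst \<phi> p + free_subst \<phi> r" for p r
    by (rule free_lift_add) (simp add: single_add)
  show "free_subst \<phi> (p * r) = free_subst \<phi> p * free_subst \<phi> r"
    by (rule free_lift_mult) (auto simp: single_add mult_single scalar_comm)
  show s: "free_subst \<phi> (scalar c) = scalar c" for c
    by (subst free_lift_single) (auto simp: zero_list_def)
  from s[of 1] show "free_subst \<phi> 1 = 1" by simp
  from s[of 0] show "free_subst \<phi> 0 = 0" by simp
  show "free_subst \<phi> (p - r) = free_subst \<phi> p - free_subst \<phi> r" using a[of "p - r" r] by simp
  show "free_subst \<phi> (gen g) = \<phi> g"
    unfolding gen_def word_def by (subst free_lift_single) auto
qed

section \<open>The quantum torus\<close>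

lemma torus_ideal: "ideal (torus_ideal q) monoid_alg"
  unfolding torus_ideal_def by (rule ideal_Idl)

lemma uq_ideal: "ideal (uq_ideal q) monoid_alg"
  unfolding uq_ideal_def by (rule ideal_Idl)

lemmas torus_simps = quot_alg_simps[OF torus_ideal, folded torus_def torus_class_def]
lemmas uq_simps = quot_alg_simps[OF uq_ideal, folded uq_def uq_class_def]
lemmas torus_class_eq_iff = coset_eq_iff[OF torus_ideal, folded torus_class_def]
lemmas uq_class_eq_iff = coset_eq_iff[OF uq_ideal, folded uq_class_def]
lemmas torus_class_self = coset_self[OF torus_ideal, folded torus_class_def]
lemmas uq_class_self = coset_self[OF uq_ideal, folded uq_class_def]
lemmas torus_class_mult_cong = coset_mult_cong[OF torus_ideal, folded torus_class_def]
lemmas ring_torus = ring_quot_alg[OF torus_ideal, folded torus_def]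
lemmas torus_finsum = finsum_coset[OF torus_ideal, folded torus_def torus_class_def]
lemmas uq_induct [consumes 1, case_names gen smult one add mult] =
  quot_free_induct[OF uq_ideal, folded uq_def uq_class_def]

lemma torus_rel: "p - r \<in> torus_rels q \<Longrightarrow> torus_class q p = torus_class q r"
  unfolding torus_class_eq_iff torus_ideal_def by (rule Idl_self)

lemma uq_rel: "p - r \<in> uq_rels q \<Longrightarrow> uq_class q p = uq_class q r"
  unfolding uq_class_eq_iff uq_ideal_def by (rule Idl_self)

lemma torus_class_rels:
  "torus_class q (gen Y * gen X) = torus_class q (scalar q * (gen X * gen Y))"
  "torus_class q (gen X * gen X') = torus_class q 1" "torus_class q (gen X' * gen X) = torus_class q 1"
  "torus_class q (gen Y * gen Y') = torus_class q 1" "torus_class q (gen Y' * gen Y) = torus_class q 1"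
  by (rule torus_rel, simp add: torus_rels_def mult.assoc)+

text \<open>
  Homomorphisms preserve inverses, and inverses in a ring are unique, so the values on \<open>x\<close> and
  \<open>y\<close> force those on the two remaining generators.
\<close>

lemma torus_hom_eqI:
  assumes f: "f \<in> alg_hom (torus q) (torus q)" and f': "f' \<in> alg_hom (torus q) (torus q)"
    and x: "f (torus_x q) = f' (torus_x q)" and y: "f (torus_y q) = f' (torus_y q)"
    and a: "a \<in> carrier (torus q)"
  shows "f a = f' a"
proof -
  interpret T: ring "torus q" by (rule ring_torus)
  have inv: "f (torus_class q (gen g')) = f' (torus_class q (gen g'))"
    if e: "f (torus_class q (gen g)) = f' (torus_class q (gen g))"
      and 1: "torus_class q (gen g * gen g') = torus_class q 1"
      and 2: "torus_class q (gen g' * gen g) = torus_class q 1" for g g'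
  proof -
    have c: "h b \<in> carrier (torus q)" if "h \<in> {f, f'}" "b \<in> carrier (torus q)" for h b
      using f f' that by (auto simp: alg_hom_def ring_hom_def)
    have l: "h (torus_class q (gen g)) \<otimes>\<^bsub>torus q\<^esub> h (torus_class q (gen g')) = \<one>\<^bsub>torus q\<^esub>"
      "h (torus_class q (gen g')) \<otimes>\<^bsub>torus q\<^esub> h (torus_class q (gen g)) = \<one>\<^bsub>torus q\<^esub>"
      if "h \<in> {f, f'}" for h
    proof -
      have h: "h \<in> ring_hom (torus q) (torus q)" using that f f' by (auto simp: alg_hom_def)
      show "h (torus_class q (gen g)) \<otimes>\<^bsub>torus q\<^esub> h (torus_class q (gen g')) = \<one>\<^bsub>torus q\<^esub>"
        "h (torus_class q (gen g')) \<otimes>\<^bsub>torus q\<^esub> h (torus_class q (gen g)) = \<one>\<^bsub>torus q\<^esub>"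
        using 1 2 ring_hom_one[OF h] by (simp_all add: torus_simps flip: ring_hom_mult[OF h])
    qed
    show ?thesis
      by (rule T.inv_unique[of _ "f (torus_class q (gen g))"])
        (use l[of f] l[of f'] c[of f] c[of f'] e in \<open>auto simp: torus_simps(1)\<close>)
  qed
  show ?thesis
  proof (rule quot_free_hom_eqI[OF torus_ideal, folded torus_def torus_class_def, OF f f' _ a])
    show "f (torus_class q (gen g)) = f' (torus_class q (gen g))" for g
      using x[unfolded torus_x_def] y[unfolded torus_y_def]
        inv[OF x[unfolded torus_x_def] torus_class_rels(2,3)]
        inv[OF y[unfolded torus_y_def] torus_class_rels(4,5)]
      by (cases g) simp_all
  qed
qed

text \<open>
  Scalars other than \<open>0\<close> are invertible, so \<open>(1 - c) a = 0\<close> forces \<open>a = 0\<close>.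
\<close>

lemma torus_smult_cancel:
  assumes "a \<in> carrier (torus q)" "a = c \<odot>\<^bsub>torus q\<^esub> a" "c \<noteq> 1"
  shows "a = \<zero>\<^bsub>torus q\<^esub>"
proof -
  note D = ideal_monoid_algD[OF torus_ideal[of q]]
  obtain p where p: "a = torus_class q p" using assms(1) by (auto simp: torus_simps)
  have "p - scalar c * p \<in> torus_ideal q"
    using assms(2) by (simp add: p torus_simps torus_class_eq_iff)
  then have "scalar (1 / (1 - c)) * (p - scalar c * p) \<in> torus_ideal q" by (rule D)
  also have "p - scalar c * p = scalar (1 - c) * p"
    by (simp add: single_diff left_diff_distrib)
  also have "scalar (1 / (1 - c)) * (scalar (1 - c) * p) = p"
    using assms(3) by (simp add: mult_single flip: mult.assoc)
  finally show ?thesis by (simp add: p torus_simps torus_class_eq_iff)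
qed

text \<open>
  The union runs over all representatives of the class; it is a single class as soon as the
  substitution respects the relations (\<open>torus_map_class\<close> below).
\<close>

definition torus_map :: "complex \<Rightarrow> (torus_gen \<Rightarrow> torus_gen free) \<Rightarrow> torus_gen free set \<Rightarrow> torus_gen free set"
  where "torus_map q \<phi> a = (\<Union>p\<in>a. torus_class q (free_subst \<phi> p))"

lemma free_subst_torus_ideal:
  assumes "\<And>r. r \<in> torus_rels q \<Longrightarrow> free_subst \<phi> r \<in> torus_ideal q" and "p \<in> torus_ideal q"
  shows "free_subst \<phi> p \<in> torus_ideal q"
proof -
  have "ideal {p. free_subst \<phi> p \<in> torus_ideal q} monoid_alg"
    by (rule ideal_monoid_algI) (auto simp: free_subst_hom ideal_monoid_algD[OF torus_ideal])
  from Idl_min[OF this, of "torus_rels q"] assms show ?thesis by (auto simp: torus_ideal_def)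
qed

lemma torus_map_class:
  assumes "\<And>r. r \<in> torus_rels q \<Longrightarrow> free_subst \<phi> r \<in> torus_ideal q"
  shows "torus_map q \<phi> (torus_class q p) = torus_class q (free_subst \<phi> p)"
proof -
  have eq: "torus_class q (free_subst \<phi> s) = torus_class q (free_subst \<phi> p)" if "s \<in> torus_class q p" for s
  proof -
    have "s - p \<in> torus_ideal q" using that by (auto simp: torus_class_def a_r_coset_def r_coset_def)
    then show ?thesis using free_subst_torus_ideal[OF assms]
      by (simp add: torus_class_eq_iff flip: free_subst_hom(6))
  qed
  have "torus_map q \<phi> (torus_class q p) = (\<Union>s\<in>torus_class q p. torus_class q (free_subst \<phi> p))"
    unfolding torus_map_def by (rule SUP_cong[OF refl eq])
  also have "\<dots> = torus_class q (free_subst \<phi> p)"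
    by (rule UN_constant_eq[OF torus_class_self]) simp
  finally show ?thesis .
qed

lemma torus_map_alg_hom:
  assumes "\<And>r. r \<in> torus_rels q \<Longrightarrow> free_subst \<phi> r \<in> torus_ideal q"
  shows "torus_map q \<phi> \<in> alg_hom (torus q) (torus q)"
  by (auto simp: alg_hom_def ring_hom_def torus_simps torus_map_class[OF assms] free_subst_hom)

section \<open>Normal forms and units of the quantum torus\<close>

fun gen_degree :: "torus_gen \<Rightarrow> int \<times> int" where
  "gen_degree X = (1, 0)"
| "gen_degree X' = (-1, 0)"
| "gen_degree Y = (0, 1)"
| "gen_degree Y' = (0, -1)"

definition degree :: "torus_gen list \<Rightarrow> int \<times> int" where
  "degree w = sum_list (map gen_degree w)"

text \<open>
  The word \<open>w\<close> of degree \<open>(i, j)\<close> equals \<open>q\<^sup>n x\<^sup>i y\<^sup>j\<close> with \<open>n = twist_exp w\<close>: moving a letter of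
  \<open>y\<close>-degree \<open>s\<close> past \<open>x\<^sup>i\<close> costs \<open>q\<close> to the power \<open>s i\<close>.
\<close>

fun twist_exp :: "torus_gen list \<Rightarrow> int" where
  "twist_exp [] = 0"
| "twist_exp (g # w) = snd (gen_degree g) * fst (degree w) + twist_exp w"

lemma degree_simps [simp]:
  "degree [] = 0" "degree (g # w) = gen_degree g + degree w" "degree (v @ w) = degree v + degree w"
  by (simp_all add: degree_def)

lemma twist_exp_append:
  "twist_exp (v @ w) = twist_exp v + twist_exp w + snd (degree v) * fst (degree w)"
  by (induct v) (auto simp: algebra_simps)

text \<open>
  The coefficients of an element in the basis \<open>x\<^sup>i y\<^sup>j\<close>, read off word by word. Multiplication of
  basis elements is \<open>(x\<^sup>i y\<^sup>j)(x\<^sup>k y\<^sup>l) = q\<^sup>j\<^sup>k x\<^sup>i\<^sup>+\<^sup>k y\<^sup>j\<^sup>+\<^sup>l\<close>, which \<open>twisted_mult\<close> below extends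
  bilinearly.
\<close>

definition normal_form :: "complex \<Rightarrow> torus_gen free \<Rightarrow> int \<times> int \<Rightarrow>\<^sub>0 complex" where
  "normal_form q p = (\<Sum>w\<in>Poly_Mapping.keys p.
     Poly_Mapping.single (degree w) (Poly_Mapping.lookup p w * q powi twist_exp w))"

definition twisted_mult ::
  "complex \<Rightarrow> (int \<times> int \<Rightarrow>\<^sub>0 complex) \<Rightarrow> (int \<times> int \<Rightarrow>\<^sub>0 complex) \<Rightarrow> int \<times> int \<Rightarrow>\<^sub>0 complex" where
  "twisted_mult q f g = (\<Sum>a\<in>Poly_Mapping.keys f. \<Sum>b\<in>Poly_Mapping.keys g.
     Poly_Mapping.single (a + b)
       (Poly_Mapping.lookup f a * Poly_Mapping.lookup g b * q powi (snd a * fst b)))"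

lemma normal_form_add: "normal_form q (p + r) = normal_form q p + normal_form q r"
  unfolding normal_form_def
  by (rule setsum_keys_plus_distrib) (auto simp: single_add distrib_right)

lemma normal_form_single:
  "normal_form q (Poly_Mapping.single w c) = Poly_Mapping.single (degree w) (c * q powi twist_exp w)"
  by (cases "c = 0") (auto simp: normal_form_def)

lemma normal_form_0 [simp]: "normal_form q 0 = 0"
  by (simp add: normal_form_def)

lemma normal_form_diff: "normal_form q (p - r) = normal_form q p - normal_form q r"
  using normal_form_add[of q "p - r" r] by simp

lemma normal_form_1: "normal_form q 1 = Poly_Mapping.single 0 1"
proof -
  have 1: "(1 :: torus_gen free) = Poly_Mapping.single [] 1" by (simp flip: zero_list_def)
  show ?thesis unfolding 1 normal_form_single by simp
qed

lemma twisted_mult_add: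
  "twisted_mult q (f + f') g = twisted_mult q f g + twisted_mult q f' g"
  "twisted_mult q f (g + g') = twisted_mult q f g + twisted_mult q f g'"
proof -
  show "twisted_mult q (f + f') g = twisted_mult q f g + twisted_mult q f' g"
    unfolding twisted_mult_def
    by (rule setsum_keys_plus_distrib) (auto simp: single_add distrib_right sum.distrib)
  have "(\<Sum>b\<in>Poly_Mapping.keys (g + g'). Poly_Mapping.single (a + b)
       (c * Poly_Mapping.lookup (g + g') b * q powi (snd a * fst b))) =
     (\<Sum>b\<in>Poly_Mapping.keys g. Poly_Mapping.single (a + b)
       (c * Poly_Mapping.lookup g b * q powi (snd a * fst b))) +
     (\<Sum>b\<in>Poly_Mapping.keys g'. Poly_Mapping.single (a + b)
       (c * Poly_Mapping.lookup g' b * q powi (snd a * fst b)))" for a c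
    by (rule setsum_keys_plus_distrib) (auto simp: single_add distrib_right distrib_left)
  then show "twisted_mult q f (g + g') = twisted_mult q f g + twisted_mult q f g'"
    by (simp add: twisted_mult_def sum.distrib)
qed

lemma twisted_mult_0 [simp]: "twisted_mult q 0 g = 0" "twisted_mult q f 0 = 0"
  by (simp_all add: twisted_mult_def)

lemma twisted_mult_single:
  "twisted_mult q (Poly_Mapping.single a c) (Poly_Mapping.single b d) =
     Poly_Mapping.single (a + b) (c * d * q powi (snd a * fst b))"
  by (cases "c = 0"; cases "d = 0") (auto simp: twisted_mult_def)

lemma normal_form_mult:
  assumes "q \<noteq> 0"
  shows "normal_form q (p * r) = twisted_mult q (normal_form q p) (normal_form q r)"
proof (induct p rule: pm_induct)
  case (single v c)
  show ?case
    by (induct r rule: pm_induct)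
      (auto simp: mult_single normal_form_single twisted_mult_single plus_list_def twist_exp_append
        power_int_add assms mult_ac distrib_left normal_form_add twisted_mult_add)
qed (auto simp: distrib_right normal_form_add twisted_mult_add)

text \<open>
  Coefficients are multiplicative for the twisted product, so the elements with
  vanishing coefficients form an ideal, and it contains the defining relations.
\<close>

lemma normal_form_torus_ideal:
  assumes q: "q \<noteq> 0" and p: "p \<in> torus_ideal q"
  shows "normal_form q p = 0"
proof -
  have "ideal {p. normal_form q p = 0} monoid_alg"
    by (rule ideal_monoid_algI) (auto simp: normal_form_add normal_form_mult[OF q])
  moreover have "torus_rels q \<subseteq> {p. normal_form q p = 0}"
    using q by (auto simp: torus_rels_def gen_def word_def mult_single normal_form_diff
      normal_form_single normal_form_1 plus_list_def zero_list_def zero_prod_def)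
  ultimately show ?thesis using Idl_min p by (auto simp: torus_ideal_def)
qed

text \<open>
  Words realising \<open>x\<^sup>i\<close> and \<open>y\<^sup>j\<close>, and the basis monomial \<open>x\<^sup>i y\<^sup>j\<close>.
\<close>

definition int_power_word :: "'g \<Rightarrow> 'g \<Rightarrow> int \<Rightarrow> 'g list" where
  "int_power_word g g' i = (if 0 \<le> i then replicate (nat i) g else replicate (nat (- i)) g')"

definition normal_word :: "int \<times> int \<Rightarrow> torus_gen list" where
  "normal_word d = int_power_word X X' (fst d) @ int_power_word Y Y' (snd d)"

lemma word_simps:
  "word (g # w) = gen g * word w" "word (v @ w) = word v * word w" "word [] = 1"
proof -
  show "word (g # w) = gen g * word w" "word (v @ w) = word v * word w"
    by (simp_all add: word_def gen_def mult_single plus_list_def)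
  show "word [] = 1" by (simp add: word_def flip: zero_list_def)
qed

lemma scalar_simps:
  "scalar a * (scalar b * p) = scalar (a * b) * p" "scalar a * scalar b = scalar (a * b)"
  by (simp_all add: mult_single flip: mult.assoc)

lemma scalar_left_comm: "p * (scalar c * r) = scalar c * (p * r)"
  by (metis mult.assoc scalar_comm)

lemma int_power_word_swap: "int_power_word g' g i = int_power_word g g' (- i)"
  by (auto simp: int_power_word_def)

context
  fixes q :: complex
begin

abbreviation cls where "cls \<equiv> torus_class q"

lemma cls_cancel:
  assumes "cls (a * b) = cls 1"
  shows "cls (a * (b * p)) = cls p" "cls (p * (a * b)) = cls p"
  using torus_class_mult_cong[OF assms refl, of p] torus_class_mult_cong[OF refl assms, of p]
  by (simp_all add: mult.assoc)

text \<open>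
  Negative powers are words in the inverse letter, so for \<open>i < 0\<close> the new letter cancels.
\<close>

lemma int_power_word_shift:
  assumes "cls (gen g * gen g') = cls 1"
  shows "cls (gen g * word (int_power_word g g' i)) = cls (word (int_power_word g g' (i + 1)))"
proof (cases "0 \<le> i")
  case True
  then have "nat (i + 1) = Suc (nat i)" by simp
  then show ?thesis using True by (simp add: int_power_word_def word_simps)
next
  case False
  define n where "n = nat (- i - 1)"
  have n: "nat (- i) = Suc n" "i = - int n - 1" using False by (auto simp: n_def)
  have "int_power_word g g' (i + 1) = replicate n g'"
    using n(2) by (auto simp: int_power_word_def)
  then show ?thesis using False n(1) cls_cancel(1)[OF assms]
    by (simp add: int_power_word_def word_simps)
qed

lemma cls_swap_sym:
  assumes "c \<noteq> 0" "cls (h * g) = cls (scalar c * (g * h))"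
  shows "cls (g * h) = cls (scalar (inverse c) * (h * g))"
  using torus_class_mult_cong[OF refl assms(2), of "scalar (inverse c)"] assms(1)
  by (simp add: scalar_simps)

text \<open>
  Insert \<open>g' g = 1\<close> in front of \<open>h g'\<close>, move \<open>h\<close> across \<open>g\<close>, and cancel \<open>g g' = 1\<close> at the end.
\<close>

lemma cls_swap_inverse:
  assumes "c \<noteq> 0" "cls (h * g) = cls (scalar c * (g * h))"
    and "cls (g * g') = cls 1" "cls (g' * g) = cls 1"
  shows "cls (h * g') = cls (scalar (inverse c) * (g' * h))"
proof -
  have "cls (h * g') = cls (g' * (g * (h * g')))"
    using cls_cancel(1)[OF assms(4)] by simp
  also have "\<dots> = cls (g' * ((g * h) * g'))" by (simp add: mult.assoc)
  also have "\<dots> = cls (g' * ((scalar (inverse c) * (h * g)) * g'))"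
    by (intro torus_class_mult_cong refl cls_swap_sym assms)
  also have "\<dots> = cls ((scalar (inverse c) * (g' * h)) * (g * g'))"
    by (simp add: mult.assoc scalar_left_comm)
  also have "\<dots> = cls (scalar (inverse c) * (g' * h))" by (rule cls_cancel(2)[OF assms(3)])
  finally show ?thesis .
qed

lemma cls_commute_replicate:
  assumes "cls (h * gen g) = cls (scalar c * (gen g * h))"
  shows "cls (h * word (replicate n g)) = cls (scalar (c ^ n) * (word (replicate n g) * h))"
proof (induct n)
  case 0 then show ?case by (simp add: word_simps)
next
  case (Suc n)
  let ?w = "word (replicate n g)"
  have "cls (h * word (replicate (Suc n) g)) = cls ((h * gen g) * ?w)"
    by (simp add: word_simps mult.assoc)
  also have "\<dots> = cls ((scalar c * (gen g * h)) * ?w)"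
    by (intro torus_class_mult_cong refl assms)
  also have "\<dots> = cls ((scalar c * gen g) * (h * ?w))" by (simp add: mult.assoc)
  also have "\<dots> = cls ((scalar c * gen g) * (scalar (c ^ n) * (?w * h)))"
    by (intro torus_class_mult_cong refl Suc)
  also have "(scalar c * gen g) * (scalar (c ^ n) * (?w * h)) =
      scalar (c ^ Suc n) * (word (replicate (Suc n) g) * h)"
    by (simp add: scalar_left_comm[of "gen g"] scalar_simps word_simps mult.assoc)
  finally show ?case .
qed

lemma cls_commute_int_power:
  assumes c: "c \<noteq> 0" and "cls (h * gen g) = cls (scalar c * (gen g * h))"
    and "cls (gen g * gen g') = cls 1" "cls (gen g' * gen g) = cls 1"
  shows "cls (h * word (int_power_word g g' i)) = cls (scalar (c powi i) * (word (int_power_word g g' i) * h))"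
  using cls_commute_replicate[OF assms(2), of "nat i"]
    cls_commute_replicate[OF cls_swap_inverse[OF assms], of "nat (- i)"]
  by (simp add: int_power_word_def power_int_def)

text \<open>
  A letter \<open>x\<^sup>\<plusminus>\<^sup>1\<close> merges with \<open>x\<^sup>i\<close> at once; a letter \<open>y\<^sup>\<plusminus>\<^sup>1\<close> has to pass \<open>x\<^sup>i\<close> first, which produces
  the power of \<open>q\<close>.
\<close>

lemma cls_gen_normal_word:
  assumes q: "q \<noteq> 0"
  shows "cls (gen g * word (normal_word d)) =
    cls (scalar (q powi (snd (gen_degree g) * fst d)) * word (normal_word (gen_degree g + d)))"
proof -
  note R = torus_class_rels[of q]
  obtain i j where d: "d = (i, j)" by force
  let ?x = "\<lambda>i. word (int_power_word X X' i)" and ?y = "\<lambda>j. word (int_power_word Y Y' j)"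
  have x: "cls (gen X * ?x i * ?y j) = cls (?x (i + 1) * ?y j)"
    by (rule torus_class_mult_cong[OF int_power_word_shift refl]) (rule R)
  have x': "cls (gen X' * ?x i * ?y j) = cls (?x (i - 1) * ?y j)"
    using torus_class_mult_cong[OF int_power_word_shift refl, of X' X "- i", OF R(3)]
    by (simp add: int_power_word_swap[of X' X])
  have y: "cls (gen Y * ?y j) = cls (?y (j + 1))"
    by (rule int_power_word_shift) (rule R)
  have y': "cls (gen Y' * ?y j) = cls (?y (j - 1))"
    using int_power_word_shift[of Y' Y "- j", OF R(5)] by (simp add: int_power_word_swap[of Y' Y])
  have move: "cls (h * ?x i * ?y j) = cls (scalar c * (?x i * ?y j'))"
    if "cls (h * ?x i) = cls (scalar c * (?x i * h))" "cls (h * ?y j) = cls (?y j')" for h c j'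
  proof -
    have "cls (h * ?x i * ?y j) = cls (scalar c * (?x i * h) * ?y j)"
      by (intro torus_class_mult_cong refl that)
    also have "\<dots> = cls (scalar c * ?x i * (h * ?y j))" by (simp add: mult.assoc)
    also have "\<dots> = cls (scalar c * ?x i * ?y j')" by (intro torus_class_mult_cong refl that)
    finally show ?thesis by (simp add: mult.assoc)
  qed
  have c: "cls (gen Y * ?x i) = cls (scalar (q powi i) * (?x i * gen Y))"
    by (rule cls_commute_int_power[OF q R(1-3)])
  have "cls (gen Y' * gen X) = cls (scalar (inverse q) * (gen X * gen Y'))"
    using cls_swap_sym[OF _ cls_swap_inverse[OF _ cls_swap_sym[OF q R(1)] R(4,5)]] q by simp
  from cls_commute_int_power[OF _ this R(2,3), of i]
  have c': "cls (gen Y' * ?x i) = cls (scalar (q powi - i) * (?x i * gen Y'))"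
    using q by (simp add: power_int_inverse power_int_minus)
  show ?thesis
    using x x' move[OF c y] move[OF c' y']
    by (cases g) (simp_all add: d normal_word_def word_simps mult.assoc add.commute[of "1::int"])
qed

lemma cls_word:
  assumes q: "q \<noteq> 0"
  shows "cls (word w) = cls (scalar (q powi twist_exp w) * word (normal_word (degree w)))"
proof (induct w)
  case Nil
  then show ?case by (simp add: normal_word_def int_power_word_def word_simps)
next
  case (Cons g w)
  let ?N = "\<lambda>w. word (normal_word (degree w))"
  have "cls (word (g # w)) = cls (gen g * (scalar (q powi twist_exp w) * ?N w))"
    unfolding word_simps by (intro torus_class_mult_cong refl Cons)
  also have "\<dots> = cls (scalar (q powi twist_exp w) * (gen g * ?N w))"
    by (simp add: scalar_left_comm)
  also have "\<dots> = cls (scalar (q powi twist_exp w) *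
      (scalar (q powi (snd (gen_degree g) * fst (degree w))) * ?N (g # w)))"
    unfolding degree_simps by (intro torus_class_mult_cong refl cls_gen_normal_word q)
  also have "\<dots> = cls (scalar (q powi twist_exp (g # w)) * ?N (g # w))"
    using q by (simp add: scalar_simps power_int_add mult.commute)
  finally show ?case .
qed

end

text \<open>
  Coefficients are defined on classes because they vanish on the ideal. Conversely every
  word is a scalar multiple of its basis monomial modulo the relations, so a class can be rebuilt
  from its coefficients. In other words, the monomials \<open>x\<^sup>i y\<^sup>j\<close> form a basis.
\<close>

lemma torus_class_eq_iff_normal_form:
  assumes q: "q \<noteq> 0"
  shows "torus_class q p = torus_class q r \<longleftrightarrow> normal_form q p = normal_form q r"
proof -
  \<comment> \<open>sends coefficients back to a combination of normal words; a section of \<open>normal_form\<close>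
    up to the relations\<close>
  define lift :: "(int \<times> int \<Rightarrow>\<^sub>0 complex) \<Rightarrow> torus_gen free" where
    "lift f = (\<Sum>d\<in>Poly_Mapping.keys f. Poly_Mapping.single (normal_word d) (Poly_Mapping.lookup f d))" for f
  have lift_add: "lift (f + g) = lift f + lift g" for f g
    unfolding lift_def by (rule setsum_keys_plus_distrib) (auto simp: single_add)
  have lift_single: "lift (Poly_Mapping.single d c) = Poly_Mapping.single (normal_word d) c" for d c
    by (cases "c = 0") (auto simp: lift_def)
  have scw: "Poly_Mapping.single w c = scalar c * word w" for w :: "torus_gen list" and c
    by (simp add: word_def mult_single)
  have *: "torus_class q p = torus_class q (lift (normal_form q p))" for p
  proof (induct p rule: pm_induct)
    case zero
    show ?case by (simp add: lift_def)
  next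
    case (single w c)
    have "torus_class q (scalar c * word w) =
        torus_class q (scalar c * (scalar (q powi twist_exp w) * word (normal_word (degree w))))"
      by (intro torus_class_mult_cong refl cls_word q)
    then show ?case
      unfolding normal_form_single lift_single
      unfolding scw[of w] scw[of "normal_word _"] scalar_simps .
  next
    case (add p r)
    show ?case
      unfolding normal_form_add lift_add torus_simps(3)[symmetric]
      by (rule arg_cong2[OF add])
  qed
  show ?thesis
  proof
    assume "torus_class q p = torus_class q r"
    then have "normal_form q (p - r) = 0"
      using normal_form_torus_ideal[OF q] by (simp add: torus_class_eq_iff)
    then show "normal_form q p = normal_form q r" by (simp add: normal_form_diff)
  qed (use *[of p] *[of r] in simp)
qed

text \<open>
  A degree of the product reached by only one pair of degrees receives only one contribution,
  so no cancellation can occur there.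
\<close>

lemma lookup_twisted_mult_unique:
  assumes "a \<in> Poly_Mapping.keys f" "b \<in> Poly_Mapping.keys g"
    and u: "\<And>a' b'. a' \<in> Poly_Mapping.keys f \<Longrightarrow> b' \<in> Poly_Mapping.keys g \<Longrightarrow> a' + b' = a + b \<Longrightarrow> a' = a \<and> b' = b"
  shows "Poly_Mapping.lookup (twisted_mult q f g) (a + b) =
    Poly_Mapping.lookup f a * Poly_Mapping.lookup g b * q powi (snd a * fst b)"
proof -
  let ?h = "\<lambda>(a', b'). Poly_Mapping.lookup f a' * Poly_Mapping.lookup g b' * q powi (snd a' * fst b')"
  have "Poly_Mapping.lookup (twisted_mult q f g) (a + b) =
      (\<Sum>z\<in>Poly_Mapping.keys f \<times> Poly_Mapping.keys g. ?h z when fst z + snd z = a + b)"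
    by (simp add: twisted_mult_def lookup_sum lookup_single sum.cartesian_product split_def)
  also have "\<dots> = (\<Sum>z\<in>{(a, b)}. ?h z when fst z + snd z = a + b)"
    by (rule sum.mono_neutral_right) (use assms in \<open>auto simp: when_def\<close>)
  finally show ?thesis by simp
qed

text \<open>
  The lexicographic order on \<open>\<int>\<^sup>2\<close> is compatible with addition, so the top terms of two factors
  multiply to the top term of the product and likewise for the bottom terms. If the product has
  a single term, its top and its bottom coincide, hence so do those of each factor.
\<close>

lemma twisted_mult_eq_single:
  assumes q: "q \<noteq> 0" and e: "twisted_mult q f g = Poly_Mapping.single d c" and c: "c \<noteq> 0"
  shows "\<exists>a b. f = Poly_Mapping.single a b"
proof -
  let ?F = "Poly_Mapping.keys f" and ?G = "Poly_Mapping.keys g"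
  have "Poly_Mapping.single d c \<noteq> 0" using c by (metis lookup_single_eq lookup_zero)
  then have "f \<noteq> 0" "g \<noteq> 0" using e by auto
  then have ne: "?F \<noteq> {}" "?G \<noteq> {}" by auto
  have sum_eq: "a + b = d" if "a \<in> ?F" "b \<in> ?G"
    "\<And>a' b'. a' \<in> ?F \<Longrightarrow> b' \<in> ?G \<Longrightarrow> a' + b' = a + b \<Longrightarrow> a' = a \<and> b' = b" for a b
  proof -
    have "Poly_Mapping.lookup (twisted_mult q f g) (a + b) =
        Poly_Mapping.lookup f a * Poly_Mapping.lookup g b * q powi (snd a * fst b)"
      by (rule lookup_twisted_mult_unique) (fact that)+
    also have "\<dots> \<noteq> 0" using that(1,2) q by (simp add: in_keys_iff)
    finally have "Poly_Mapping.lookup (Poly_Mapping.single d c) (a + b) \<noteq> 0" unfolding e .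
    then show ?thesis by (metis lookup_single_not_eq)
  qed
  \<comment> \<open>the extreme pairs are the only ones with their sum\<close>
  have rigid: "a' = a \<and> b' = b"
    if "a' \<le> a" "b' \<le> b" "a' + b' = a + b" for a a' b b' :: "int \<times> int"
  proof -
    have "fst a' + fst b' = fst a + fst b" "snd a' + snd b' = snd a + snd b"
      using arg_cong[OF that(3), of fst] arg_cong[OF that(3), of snd] by auto
    moreover have "fst a' < fst a \<or> fst a' = fst a \<and> snd a' \<le> snd a"
      "fst b' < fst b \<or> fst b' = fst b \<and> snd b' \<le> snd b"
      using that(1,2) by (auto simp: less_eq_prod_def)
    ultimately have "fst a' = fst a \<and> snd a' = snd a" "fst b' = fst b \<and> snd b' = snd b"
      by linarith+
    then show ?thesis by (simp add: prod_eq_iff)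
  qed
  have "Max ?F + Max ?G = d"
    using ne by (intro sum_eq rigid Max_in Max_ge) auto
  moreover have "Min ?F + Min ?G = d"
  proof (intro sum_eq)
    fix a b assume "a \<in> ?F" "b \<in> ?G" "a + b = Min ?F + Min ?G"
    then show "a = Min ?F \<and> b = Min ?G"
      using rigid[of "Min ?F" a "Min ?G" b] by auto
  qed (use ne in auto)
  moreover have le: "Min ?F \<le> Max ?F" "Min ?G \<le> Max ?G"
    using ne by (auto intro: Min_le_iff[THEN iffD2])
  ultimately have eq: "Min ?F = Max ?F"
    using rigid[OF le] by simp
  have "?F \<subseteq> {Max ?F}"
  proof
    fix a assume "a \<in> ?F"
    then have "Min ?F \<le> a" "a \<le> Max ?F" by auto
    then show "a \<in> {Max ?F}" using eq by simp
  qed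
  then have "f = Poly_Mapping.single (Max ?F) (Poly_Mapping.lookup f (Max ?F))"
    by (intro poly_mapping_eqI) (auto simp: lookup_single when_def in_keys_iff)
  then show ?thesis by blast
qed

text \<open>
  The coefficients of \<open>1\<close> are concentrated in one degree, so the factors of \<open>1\<close> are monomials.
\<close>

lemma torus_unit_monomial:
  assumes q: "q \<noteq> 0" and "torus_class q (p * r) = torus_class q 1"
  shows "\<exists>d c. normal_form q p = Poly_Mapping.single d c"
proof -
  have "twisted_mult q (normal_form q p) (normal_form q r) = Poly_Mapping.single 0 1"
    using assms(2) by (simp add: torus_class_eq_iff_normal_form[OF q] normal_form_mult[OF q] normal_form_1)
  from twisted_mult_eq_single[OF q this] show ?thesis by simp
qed

fun rescale :: "complex \<Rightarrow> complex \<Rightarrow> torus_gen \<Rightarrow> torus_gen free" where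
  "rescale \<alpha> \<beta> X = scalar \<alpha> * gen X"
| "rescale \<alpha> \<beta> X' = scalar (inverse \<alpha>) * gen X'"
| "rescale \<alpha> \<beta> Y = scalar \<beta> * gen Y"
| "rescale \<alpha> \<beta> Y' = scalar (inverse \<beta>) * gen Y'"

definition weight :: "complex \<Rightarrow> complex \<Rightarrow> int \<times> int \<Rightarrow> complex" where
  "weight \<alpha> \<beta> d = \<alpha> powi fst d * \<beta> powi snd d"

lemma rescale_single:
  assumes "\<alpha> \<noteq> 0" "\<beta> \<noteq> 0"
  shows "free_subst (rescale \<alpha> \<beta>) (Poly_Mapping.single w c) =
    Poly_Mapping.single w (weight \<alpha> \<beta> (degree w) * c)"
proof -
  have g: "rescale \<alpha> \<beta> g = scalar (weight \<alpha> \<beta> (gen_degree g)) * gen g" for g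
    by (cases g) (auto simp: weight_def power_int_minus)
  have "prod_list (map (rescale \<alpha> \<beta>) w) = scalar (weight \<alpha> \<beta> (degree w)) * word w"
  proof (induct w)
    case (Cons h w)
    have "weight \<alpha> \<beta> (gen_degree h + degree w) = weight \<alpha> \<beta> (gen_degree h) * weight \<alpha> \<beta> (degree w)"
      using assms by (simp add: weight_def power_int_add)
    then show ?case
      using Cons by (simp add: g word_simps mult.assoc scalar_left_comm[of "gen h"] scalar_simps)
  qed (simp add: weight_def word_simps)
  then show ?thesis
    by (subst free_lift_single) (auto simp: word_def mult_single mult.commute)
qed

lemma normal_form_rescale:
  assumes "\<alpha> \<noteq> 0" "\<beta> \<noteq> 0" "normal_form q p = Poly_Mapping.single d c"
  shows "normal_form q (free_subst (rescale \<alpha> \<beta>) p) = Poly_Mapping.single d (weight \<alpha> \<beta> d * c)"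
proof -
  let ?D = "\<lambda>f. \<Sum>d\<in>Poly_Mapping.keys f. Poly_Mapping.single d (weight \<alpha> \<beta> d * Poly_Mapping.lookup f d)"
  have D_add: "?D (f + g) = ?D f + ?D g" for f g
    by (rule setsum_keys_plus_distrib) (auto simp: single_add distrib_left)
  have D_single: "?D (Poly_Mapping.single d c) = Poly_Mapping.single d (weight \<alpha> \<beta> d * c)" for d c
    by (cases "c = 0") auto
  have "normal_form q (free_subst (rescale \<alpha> \<beta>) p) = ?D (normal_form q p)"
  proof (induct p rule: pm_induct)
    case zero show ?case by (simp add: free_subst_hom)
  next
    case (single w c)
    then show ?case unfolding normal_form_single rescale_single[OF assms(1,2)]
      by (subst D_single) (simp add: mult.assoc)
  next
    case (add p r)
    then show ?case by (simp only: free_subst_hom normal_form_add D_add add)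
  qed
  then show ?thesis unfolding assms(3) by (subst (asm) D_single)
qed

lemma torus_ideal_iff:
  assumes "q \<noteq> 0"
  shows "p \<in> torus_ideal q \<longleftrightarrow> normal_form q p = 0"
  using torus_class_eq_iff_normal_form[OF assms, of p 0] by (simp add: torus_class_eq_iff)

text \<open>
  A diagonal map only multiplies each coefficient by a weight, so it preserves the
  vanishing of all of them.
\<close>

lemma rescale_torus_ideal:
  assumes "q \<noteq> 0" "\<alpha> \<noteq> 0" "\<beta> \<noteq> 0" "p \<in> torus_ideal q"
  shows "free_subst (rescale \<alpha> \<beta>) p \<in> torus_ideal q"
  using normal_form_rescale[OF assms(2,3), of q p 0 0] assms(1,4) by (simp add: torus_ideal_iff)

section \<open>Sign characters\<close>

fun sign_character_gen :: "complex \<Rightarrow> uq_gen \<Rightarrow> complex" where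
  "sign_character_gen \<epsilon> K = \<epsilon>"
| "sign_character_gen \<epsilon> K' = \<epsilon>"
| "sign_character_gen \<epsilon> E = 0"
| "sign_character_gen \<epsilon> F = 0"

text \<open>
  For \<open>\<epsilon>\<^sup>2 = 1\<close> this is the pullback to the free algebra of a one-dimensional representation of
  \<open>U\<^sub>q(sl\<^sub>2)\<close>; for \<open>\<epsilon> = 1\<close> that is the counit.
\<close>

definition sign_character :: "complex \<Rightarrow> uq_gen free \<Rightarrow> complex" where
  "sign_character \<epsilon> = free_lift (\<lambda>c. c) (sign_character_gen \<epsilon>)"

lemma sign_character_hom:
  "sign_character \<epsilon> (p + r) = sign_character \<epsilon> p + sign_character \<epsilon> r"
  "sign_character \<epsilon> (p * r) = sign_character \<epsilon> p * sign_character \<epsilon> r"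
  "sign_character \<epsilon> 1 = 1" "sign_character \<epsilon> 0 = 0" "sign_character \<epsilon> (scalar c) = c"
  "sign_character \<epsilon> (p - r) = sign_character \<epsilon> p - sign_character \<epsilon> r"
  "sign_character \<epsilon> (gen g) = sign_character_gen \<epsilon> g"
  "sign_character \<epsilon> (Poly_Mapping.single w c) = c * sign_character \<epsilon> (word w)"
proof -
  show a: "sign_character \<epsilon> (p + r) = sign_character \<epsilon> p + sign_character \<epsilon> r" for p r
    unfolding sign_character_def by (rule free_lift_add) simp
  show m: "sign_character \<epsilon> (p * r) = sign_character \<epsilon> p * sign_character \<epsilon> r" for p r
    unfolding sign_character_def by (rule free_lift_mult) auto
  show s: "sign_character \<epsilon> (scalar c) = c" for c
    unfolding sign_character_def by (subst free_lift_single) (auto simp: zero_list_def)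
  from s[of 1] show "sign_character \<epsilon> 1 = 1" by simp
  from s[of 0] show "sign_character \<epsilon> 0 = 0" by simp
  show "sign_character \<epsilon> (p - r) = sign_character \<epsilon> p - sign_character \<epsilon> r"
    using a[of "p - r" r] by simp
  show "sign_character \<epsilon> (gen g) = sign_character_gen \<epsilon> g"
    unfolding sign_character_def gen_def word_def by (subst free_lift_single) auto
  show "sign_character \<epsilon> (Poly_Mapping.single w c) = c * sign_character \<epsilon> (word w)"
    using m[of "scalar c" "word w"] by (simp add: s word_def mult_single)
qed

lemma sign_character_1: "sign_character 1 = free_counit"
proof -
  have "sign_character_gen 1 = counit_gen"
  proof
    show "sign_character_gen 1 g = counit_gen g" for g by (cases g) auto
  qed
  then show ?thesis by (simp add: sign_character_def free_counit_def)
qed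

text \<open>
  For \<open>\<epsilon>\<^sup>2 = 1\<close> the images of \<open>k\<close> and \<open>k\<^sup>-\<^sup>1\<close> agree, so the relation for \<open>e f - f e\<close>
  becomes \<open>0 = 0\<close>; the relations that move \<open>k\<close> past \<open>e\<close> and \<open>f\<close> hold because both sides vanish.
\<close>

lemma sign_character_uq_ideal:
  assumes "\<epsilon> * \<epsilon> = 1" "p \<in> uq_ideal q"
  shows "sign_character \<epsilon> p = 0"
proof -
  have "ideal {p. sign_character \<epsilon> p = 0} monoid_alg"
    by (rule ideal_monoid_algI) (auto simp: sign_character_hom)
  from Idl_min[OF this, of "uq_rels q"] assms show ?thesis
    by (auto simp: uq_ideal_def uq_rels_def sign_character_hom)
qed

text \<open>
  The character \<open>\<chi>\<^sub>\<epsilon> \<otimes> \<chi>\<^sub>\<delta>\<close> of the tensor square.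
\<close>

definition sign_bicharacter :: "complex \<Rightarrow> complex \<Rightarrow> uq_gen free2 \<Rightarrow> complex" where
  "sign_bicharacter \<epsilon> \<delta> t = (\<Sum>z\<in>Poly_Mapping.keys t. Poly_Mapping.lookup t z *
     (sign_character \<epsilon> (word (fst z)) * sign_character \<delta> (word (snd z))))"

lemma sign_bicharacter_add:
  "sign_bicharacter \<epsilon> \<delta> (s + t) = sign_bicharacter \<epsilon> \<delta> s + sign_bicharacter \<epsilon> \<delta> t"
  unfolding sign_bicharacter_def by (rule setsum_keys_plus_distrib) (auto simp: distrib_right)

lemma sign_bicharacter_0 [simp]: "sign_bicharacter \<epsilon> \<delta> 0 = 0"
  by (simp add: sign_bicharacter_def)

lemma sign_bicharacter_single:
  "sign_bicharacter \<epsilon> \<delta> (Poly_Mapping.single (u, v) c) =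
     c * (sign_character \<epsilon> (word u) * sign_character \<delta> (word v))"
  by (cases "c = 0") (auto simp: sign_bicharacter_def)

lemma sign_bicharacter_mult:
  "sign_bicharacter \<epsilon> \<delta> (s * t) = sign_bicharacter \<epsilon> \<delta> s * sign_bicharacter \<epsilon> \<delta> t"
proof (induct s rule: pm_induct)
  case (single k c)
  obtain u v where k: "k = (u, v)" by force
  show ?case
  proof (induct t rule: pm_induct)
    case (single l d)
    obtain u' v' where l: "l = (u', v')" by force
    show ?case
      by (simp add: k l mult_single sign_bicharacter_single plus_list_def word_simps sign_character_hom)
  qed (auto simp: distrib_left sign_bicharacter_add)
qed (auto simp: distrib_right sign_bicharacter_add)

lemma sign_bicharacter_tensor:
  "sign_bicharacter \<epsilon> \<delta> (tensor p r) = sign_character \<epsilon> p * sign_character \<delta> r"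
proof (induct p rule: pm_induct)
  case (single u c)
  show ?case
    by (induct r rule: pm_induct)
      (auto simp: tensor_single sign_bicharacter_single sign_character_hom tensor_add
        sign_bicharacter_add algebra_simps)
qed (auto simp: tensor_add sign_bicharacter_add sign_character_hom algebra_simps)

lemma sign_bicharacter_uq_ideal2:
  assumes "\<epsilon> * \<epsilon> = 1" "\<delta> * \<delta> = 1" "t \<in> uq_ideal2 q"
  shows "sign_bicharacter \<epsilon> \<delta> t = 0"
proof -
  have "ideal {t. sign_bicharacter \<epsilon> \<delta> t = 0} monoid_alg"
    by (rule ideal_monoid_algI) (auto simp: sign_bicharacter_add sign_bicharacter_mult)
  moreover have "{tensor p r | p r. p \<in> uq_ideal q \<or> r \<in> uq_ideal q} \<subseteq> {t. sign_bicharacter \<epsilon> \<delta> t = 0}"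
    using assms(1,2) by (auto simp: sign_bicharacter_tensor sign_character_uq_ideal)
  ultimately show ?thesis
    using Idl_min assms(3) unfolding uq_ideal2_def by blast
qed

text \<open>
  Both sides are multiplicative in \<open>p\<close>, so generators suffice: \<open>k\<close> and \<open>k\<^sup>-\<^sup>1\<close> are grouplike, and
  every term in the comultiplication of \<open>e\<close> or \<open>f\<close> has a factor that is sent to \<open>0\<close>.
\<close>

lemma sign_bicharacter_comult:
  "sign_bicharacter \<epsilon> \<delta> (free_comult p) = sign_character (\<epsilon> * \<delta>) p"
proof (induct p rule: pm_induct)
  case zero show ?case by (simp add: free_comult_hom sign_character_hom)
next
  case (add p r)
  then show ?case by (simp add: free_comult_hom sign_character_hom sign_bicharacter_add)
next
  case (single w c)
  have g: "sign_bicharacter \<epsilon> \<delta> (comult_gen g) = sign_character_gen (\<epsilon> * \<delta>) g" for g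
    by (cases g) (auto simp: sign_bicharacter_tensor sign_bicharacter_add sign_character_hom)
  have s: "sign_bicharacter \<epsilon> \<delta> (scalar c) = c" for c
    using sign_bicharacter_single[of \<epsilon> \<delta> "[]" "[]" c]
    by (simp add: word_simps sign_character_hom zero_prod_def zero_list_def)
  have w: "sign_bicharacter \<epsilon> \<delta> (free_comult (word w)) = sign_character (\<epsilon> * \<delta>) (word w)"
  proof (induct w)
    case Nil show ?case using s[of 1] by (simp add: word_simps free_comult_hom sign_character_hom)
  qed (simp add: word_simps free_comult_hom sign_character_hom sign_bicharacter_mult g)
  have "Poly_Mapping.single w c = scalar c * word w" by (simp add: word_def mult_single)
  then show ?case by (simp only: free_comult_hom sign_character_hom(2,5) sign_bicharacter_mult s w)
qed

section \<open>The sign symmetries\<close>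

lemma weight_square:
  assumes "\<alpha> * \<alpha> = 1" "\<beta> * \<beta> = 1"
  shows "weight \<alpha> \<beta> d * weight \<alpha> \<beta> d = 1"
proof -
  have "weight \<alpha> \<beta> d * weight \<alpha> \<beta> d = (\<alpha> * \<alpha>) powi fst d * (\<beta> * \<beta>) powi snd d"
    unfolding power_int_mult_distrib by (simp add: weight_def mult_ac)
  then show ?thesis by (simp add: assms)
qed

text \<open>
  The action is built on the free algebra, where \<open>\<sigma>\<close> is already an involution, and passes to the
  quotient afterwards. The map \<open>sign_part \<epsilon>\<close> is the projection onto the eigenspace of \<open>\<sigma>\<close>
  for \<open>\<epsilon>\<close>, and \<open>free_action p\<close> multiplies each eigenspace by the corresponding character of \<open>p\<close>.
\<close>

context
  fixes \<alpha> \<beta> :: complex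
  assumes sq: "\<alpha> * \<alpha> = 1" "\<beta> * \<beta> = 1"
begin

abbreviation \<sigma> where "\<sigma> \<equiv> free_subst (rescale \<alpha> \<beta>)"

definition sign_part :: "complex \<Rightarrow> torus_gen free \<Rightarrow> torus_gen free" where
  "sign_part \<epsilon> a = scalar (1 / 2) * (a + scalar \<epsilon> * \<sigma> a)"

definition free_action :: "uq_gen free \<Rightarrow> torus_gen free \<Rightarrow> torus_gen free" where
  "free_action p a = scalar (sign_character 1 p) * sign_part 1 a +
     scalar (sign_character (-1) p) * sign_part (-1) a"

lemma nonzero: "\<alpha> \<noteq> 0" "\<beta> \<noteq> 0"
  using sq by auto

lemma \<sigma>_\<sigma>: "\<sigma> (\<sigma> a) = a"
proof (induct a rule: pm_induct)
  case (single w c)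
  show ?case by (simp add: rescale_single[OF nonzero] weight_square[OF sq] flip: mult.assoc)
qed (auto simp: free_subst_hom)

lemma sign_part_add: "sign_part \<epsilon> (a + b) = sign_part \<epsilon> a + sign_part \<epsilon> b"
  by (simp add: sign_part_def free_subst_hom algebra_simps)

lemma sign_part_scalar: "sign_part \<epsilon> (scalar c * a) = scalar c * sign_part \<epsilon> a"
  by (simp add: sign_part_def free_subst_hom scalar_simps distrib_left mult_ac)

lemma \<sigma>_sign_part: "\<epsilon> * \<epsilon> = 1 \<Longrightarrow> \<sigma> (sign_part \<epsilon> a) = scalar \<epsilon> * sign_part \<epsilon> a"
  by (simp add: sign_part_def free_subst_hom scalar_simps distrib_left mult_ac \<sigma>_\<sigma>)

lemma sign_part_sum: "sign_part 1 a + sign_part (-1) a = a"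
proof -
  have "sign_part 1 a + sign_part (-1) a = scalar (1 / 2) * a + scalar (1 / 2) * a"
    by (simp add: sign_part_def single_uminus algebra_simps)
  also have "\<dots> = a" by (simp flip: distrib_right single_add)
  finally show ?thesis .
qed

lemma sign_part_eigen:
  assumes "\<sigma> c = scalar \<delta> * c"
  shows "sign_part \<epsilon> c = scalar ((1 + \<epsilon> * \<delta>) / 2) * c"
proof -
  have "sign_part \<epsilon> c = (scalar (1 / 2) * (1 + scalar (\<epsilon> * \<delta>))) * c"
    by (simp add: sign_part_def assms scalar_simps algebra_simps)
  also have "scalar (1 / 2) * (1 + scalar (\<epsilon> * \<delta>)) = (scalar ((1 + \<epsilon> * \<delta>) / 2) :: torus_gen free)"
    by (simp add: distrib_left scalar_simps add_divide_distrib single_add)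
  finally show ?thesis .
qed

lemma free_action_eigen:
  assumes "\<sigma> c = scalar \<delta> * c" "\<delta> \<in> {-1, 1}"
  shows "free_action p c = scalar (sign_character \<delta> p) * c"
  using assms(2) by (auto simp: free_action_def sign_part_eigen[OF assms(1)])

lemma free_action_add: "free_action p (a + b) = free_action p a + free_action p b"
  by (simp add: free_action_def sign_part_add algebra_simps)

lemma free_action_scalar: "free_action p (scalar c * a) = scalar c * free_action p a"
  by (simp add: free_action_def sign_part_scalar distrib_left scalar_simps mult.commute)

lemma free_action_diff: "free_action p (a - b) = free_action p a - free_action p b"
  using free_action_add[of p "a - b" b] by simp

lemma free_action_add_left: "free_action (p + r) a = free_action p a + free_action r a"
  by (simp add: free_action_def sign_character_hom single_add algebra_simps)

lemma free_action_scalar_left: "free_action (scalar c * p) a = scalar c * free_action p a"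
  by (simp add: free_action_def sign_character_hom(2,5) distrib_left scalar_simps)

lemma free_action_1: "free_action 1 a = a"
  by (simp add: free_action_def sign_character_hom sign_part_sum)

lemma free_action_sign_part:
  "\<epsilon> \<in> {-1, 1} \<Longrightarrow> free_action p (sign_part \<epsilon> a) = scalar (sign_character \<epsilon> p) * sign_part \<epsilon> a"
  by (rule free_action_eigen[OF \<sigma>_sign_part]) auto

lemma free_action_mult_left: "free_action (p * r) a = free_action p (free_action r a)"
  unfolding free_action_def[of r a] free_action_add free_action_scalar
  by (simp add: free_action_sign_part scalar_simps free_action_def[of "p * r"] sign_character_hom mult.commute)

lemma free_action_unit: "free_action p 1 = scalar (free_counit p)"
  using free_action_eigen[of 1 1 p] by (simp add: free_subst_hom sign_character_1)

text \<open>
  \<open>\<sigma>\<close> is multiplicative, so the product of eigenvectors for \<open>\<epsilon>\<close> and \<open>\<delta>\<close> is one for \<open>\<epsilon>\<delta>\<close>.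
\<close>

lemma free_action_mult:
  "free_action p (a * b) = (\<Sum>\<epsilon>\<in>{-1, 1}. \<Sum>\<delta>\<in>{-1, 1}.
     scalar (sign_character (\<epsilon> * \<delta>) p) * (sign_part \<epsilon> a * sign_part \<delta> b))"
proof -
  have e: "free_action p (sign_part \<epsilon> a * sign_part \<delta> b) =
      scalar (sign_character (\<epsilon> * \<delta>) p) * (sign_part \<epsilon> a * sign_part \<delta> b)"
    if "\<epsilon> \<in> {-1, 1}" "\<delta> \<in> {-1, 1}" for \<epsilon> \<delta>
  proof (rule free_action_eigen)
    have "\<sigma> (sign_part \<epsilon> a * sign_part \<delta> b) = (scalar \<epsilon> * sign_part \<epsilon> a) * (scalar \<delta> * sign_part \<delta> b)"
      using that by (simp only: free_subst_hom) (auto simp: \<sigma>_sign_part)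
    then show "\<sigma> (sign_part \<epsilon> a * sign_part \<delta> b) = scalar (\<epsilon> * \<delta>) * (sign_part \<epsilon> a * sign_part \<delta> b)"
      by (simp add: mult.assoc scalar_left_comm[of "sign_part \<epsilon> a"] scalar_simps)
  qed (use that in auto)
  have "a * b = (sign_part (-1) a + sign_part 1 a) * (sign_part (-1) b + sign_part 1 b)"
    by (simp only: add.commute[of "sign_part (-1) _"] sign_part_sum)
  also have "\<dots> = (\<Sum>\<epsilon>\<in>{-1, 1}. \<Sum>\<delta>\<in>{-1, 1}. sign_part \<epsilon> a * sign_part \<delta> b)"
    by (simp add: algebra_simps)
  finally have "free_action p (a * b) =
      free_action p (\<Sum>\<epsilon>\<in>{-1, 1}. \<Sum>\<delta>\<in>{-1, 1}. sign_part \<epsilon> a * sign_part \<delta> b)" by simp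
  then show ?thesis by (simp add: free_action_add e)
qed

text \<open>
  The left-hand side is the Sweedler sum on representatives. On each pair of eigenspaces it is the
  scalar given by the bicharacter, and comparison with \<open>free_action_mult\<close> reduces the module
  algebra axiom to \<open>sign_bicharacter_comult\<close>.
\<close>

lemma free_action_tensor:
  "(\<Sum>z\<in>Poly_Mapping.keys t. scalar (Poly_Mapping.lookup t z) *
      (free_action (word (fst z)) a * free_action (word (snd z)) b)) =
   (\<Sum>\<epsilon>\<in>{-1, 1}. \<Sum>\<delta>\<in>{-1, 1}.
      scalar (sign_bicharacter \<epsilon> \<delta> t) * (sign_part \<epsilon> a * sign_part \<delta> b))"
  (is "?T t = _")
proof (induct t rule: pm_induct)
  case zero show ?case by simp
next
  case (add s t)
  have "?T (s + t) = ?T s + ?T t"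
    by (rule setsum_keys_plus_distrib) (auto simp: single_add distrib_right)
  then show ?case by (simp only: add) (simp add: sign_bicharacter_add single_add algebra_simps)
next
  case (single z c)
  obtain u v where z: "z = (u, v)" by force
  have "?T (Poly_Mapping.single z c) = scalar c * (free_action (word u) a * free_action (word v) b)"
    by (cases "c = 0") (auto simp: z)
  also have "\<dots> = scalar c * (scalar (sign_character 1 (word u)) * sign_part 1 a *
        (scalar (sign_character 1 (word v)) * sign_part 1 b)
      + scalar (sign_character 1 (word u)) * sign_part 1 a *
        (scalar (sign_character (-1) (word v)) * sign_part (-1) b)
      + (scalar (sign_character (-1) (word u)) * sign_part (-1) a *
        (scalar (sign_character 1 (word v)) * sign_part 1 b)
      + scalar (sign_character (-1) (word u)) * sign_part (-1) a *
        (scalar (sign_character (-1) (word v)) * sign_part (-1) b)))"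
    by (simp add: free_action_def distrib_left distrib_right)
  finally show ?case
    by (simp add: z sign_bicharacter_single mult.assoc scalar_left_comm[of "sign_part _ a"]
      scalar_simps distrib_left add_ac)
qed

context
  fixes q :: complex
  assumes q: "q \<noteq> 0"
begin

lemma free_action_torus_ideal: "a \<in> torus_ideal q \<Longrightarrow> free_action p a \<in> torus_ideal q"
  unfolding free_action_def sign_part_def
  by (intro ideal_monoid_algD[OF torus_ideal] rescale_torus_ideal[OF q nonzero])

text \<open>
  The union runs over all representatives of the two classes; \<open>sign_symmetry_class\<close> shows
  that they all yield the same class.
\<close>

definition sign_symmetry :: "uq_gen free set \<Rightarrow> torus_gen free set \<Rightarrow> torus_gen free set" where
  "sign_symmetry = (\<lambda>h\<in>carrier (uq q). \<lambda>a\<in>carrier (torus q).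
     \<Union>p\<in>h. \<Union>b\<in>a. torus_class q (free_action p b))"

lemma sign_symmetry_class:
  "sign_symmetry (uq_class q p) (torus_class q a) = torus_class q (free_action p a)"
proof -
  have eq: "torus_class q (free_action r b) = torus_class q (free_action p a)"
    if "r \<in> uq_class q p" "b \<in> torus_class q a" for r b
  proof -
    have "r - p \<in> uq_ideal q" "b - a \<in> torus_ideal q"
      using that by (auto simp: uq_class_def torus_class_def a_r_coset_def r_coset_def)
    then have "sign_character \<epsilon> r = sign_character \<epsilon> p" if "\<epsilon> \<in> {-1, 1}" for \<epsilon>
      using sign_character_uq_ideal[of \<epsilon> "r - p" q] that by (auto simp: sign_character_hom)
    then have "free_action r b = free_action p b" by (simp add: free_action_def)
    moreover have "free_action p b - free_action p a \<in> torus_ideal q"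
      using free_action_torus_ideal \<open>b - a \<in> torus_ideal q\<close> by (simp flip: free_action_diff)
    ultimately show ?thesis by (simp add: torus_class_eq_iff)
  qed
  have "sign_symmetry (uq_class q p) (torus_class q a) =
      (\<Union>r\<in>uq_class q p. \<Union>b\<in>torus_class q a. torus_class q (free_action r b))"
    by (simp add: sign_symmetry_def torus_simps uq_simps)
  also have "\<dots> = (\<Union>r\<in>uq_class q p. \<Union>b\<in>torus_class q a. torus_class q (free_action p a))"
    by (intro SUP_cong refl eq)
  also have "\<dots> = torus_class q (free_action p a)"
    using uq_class_self torus_class_self by (simp add: UN_constant_eq) blast
  finally show ?thesis .
qed

lemma tensor_act_sign_symmetry:
  "tensor_act q sign_symmetry t (torus_class q a) (torus_class q b) =
     torus_class q (\<Sum>\<epsilon>\<in>{-1, 1}. \<Sum>\<delta>\<in>{-1, 1}.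
       scalar (sign_bicharacter \<epsilon> \<delta> t) * (sign_part \<epsilon> a * sign_part \<delta> b))"
  unfolding free_action_tensor[symmetric] tensor_act_def
  by (simp add: sign_symmetry_class torus_simps torus_finsum)

lemma symmetry_sign_symmetry: "symmetry q sign_symmetry"
  unfolding symmetry_def
proof (intro conjI ballI)
  have ext: "sign_symmetry (uq_class q p) \<in> extensional (carrier (torus q))" for p
    by (simp add: sign_symmetry_def uq_simps)
  show "sign_symmetry \<in> extensional (carrier (uq q))"
    by (simp add: sign_symmetry_def)
  have closed: "sign_symmetry (uq_class q p) \<in> carrier (end_alg (torus q))" for p
    using ext[of p] by (auto simp: end_alg_def PiE_def torus_simps sign_symmetry_class
      free_action_add free_action_scalar)
  have eqI: "sign_symmetry (uq_class q p) = f"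
    if "f \<in> extensional (carrier (torus q))"
      "\<And>a. f (torus_class q a) = torus_class q (free_action p a)" for p f
    by (rule extensionalityI[OF ext that(1)]) (auto simp: torus_simps sign_symmetry_class that(2))
  show "sign_symmetry \<in> alg_hom (uq q) (end_alg (torus q))"
    unfolding alg_hom_def
  proof (intro CollectI conjI ring_hom_memI allI ballI)
    fix x y assume "x \<in> carrier (uq q)" "y \<in> carrier (uq q)"
    then obtain p r where xy: "x = uq_class q p" "y = uq_class q r" by (auto simp: uq_simps)
    show "sign_symmetry (x \<otimes>\<^bsub>uq q\<^esub> y) = sign_symmetry x \<otimes>\<^bsub>end_alg (torus q)\<^esub> sign_symmetry y"
      unfolding xy uq_simps
      by (rule eqI) (auto simp: end_alg_def compose_def torus_simps sign_symmetry_class free_action_mult_left)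
    show "sign_symmetry (x \<oplus>\<^bsub>uq q\<^esub> y) = sign_symmetry x \<oplus>\<^bsub>end_alg (torus q)\<^esub> sign_symmetry y"
      unfolding xy uq_simps
      by (rule eqI) (auto simp: end_alg_def torus_simps sign_symmetry_class free_action_add_left)
  next
    show "sign_symmetry \<one>\<^bsub>uq q\<^esub> = \<one>\<^bsub>end_alg (torus q)\<^esub>"
      unfolding uq_simps
      by (rule eqI) (auto simp: end_alg_def torus_simps free_action_1)
  next
    fix c x assume "x \<in> carrier (uq q)"
    then obtain p where x: "x = uq_class q p" by (auto simp: uq_simps)
    show "sign_symmetry (c \<odot>\<^bsub>uq q\<^esub> x) = c \<odot>\<^bsub>end_alg (torus q)\<^esub> sign_symmetry x"
      unfolding x uq_simps
      by (rule eqI) (auto simp: end_alg_def torus_simps sign_symmetry_class free_action_scalar_left)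
  qed (use closed in \<open>auto simp: uq_simps\<close>)
  fix h assume "h \<in> carrier (uq q)"
  then obtain p where h: "h = uq_class q p" by (auto simp: uq_simps)
  show "sign_symmetry h \<one>\<^bsub>torus q\<^esub> = uq_counit h \<odot>\<^bsub>torus q\<^esub> \<one>\<^bsub>torus q\<^esub>"
    by (simp add: h uq_counit_class torus_simps sign_symmetry_class free_action_unit)
  fix a b t assume "a \<in> carrier (torus q)" "b \<in> carrier (torus q)" and t: "t \<in> uq_comult q h"
  then obtain a' b' where ab: "a = torus_class q a'" "b = torus_class q b'" by (auto simp: torus_simps)
  obtain j where j: "j \<in> uq_ideal2 q" "t = j + free_comult p"
    using t by (auto simp: h uq_comult_class[OF q] a_r_coset_def r_coset_def)
  have "sign_bicharacter \<epsilon> \<delta> t = sign_character (\<epsilon> * \<delta>) p"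
    if "\<epsilon> \<in> {-1, 1}" "\<delta> \<in> {-1, 1}" for \<epsilon> \<delta>
    using sign_bicharacter_uq_ideal2[of \<epsilon> \<delta> j q] that j(1)
    unfolding j(2) sign_bicharacter_add sign_bicharacter_comult by auto
  then show "sign_symmetry h (a \<otimes>\<^bsub>torus q\<^esub> b) = tensor_act q sign_symmetry t a b"
    unfolding h ab torus_simps sign_symmetry_class tensor_act_sign_symmetry free_action_mult by simp
qed

end
end

lemma sign_symmetry_k:
  assumes "\<alpha> * \<alpha> = 1" "\<beta> * \<beta> = 1" "q \<noteq> 0"
  shows "sign_symmetry \<alpha> \<beta> q (uq_k q) (torus_class q a) = torus_class q (free_subst (rescale \<alpha> \<beta>) a)"
proof -
  have "free_action \<alpha> \<beta> (gen K) a = scalar (1 / 2) * (free_subst (rescale \<alpha> \<beta>) a + free_subst (rescale \<alpha> \<beta>) a)"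
    by (simp add: free_action_def[OF assms(1,2)] sign_part_def[OF assms(1,2)] sign_character_hom single_uminus algebra_simps)
  also have "\<dots> = free_subst (rescale \<alpha> \<beta>) a"
    by (simp add: distrib_left flip: distrib_right single_add)
  finally show ?thesis by (simp add: uq_k_def sign_symmetry_class[OF assms])
qed

lemma weight_constants_sign_symmetry:
  assumes "\<alpha> * \<alpha> = 1" "\<beta> * \<beta> = 1" "q \<noteq> 0"
  shows "weight_constants q (sign_symmetry \<alpha> \<beta> q) \<alpha> \<beta>"
  using assms(1,2)
  by (auto simp: weight_constants_def torus_x_def torus_y_def sign_symmetry_k[OF assms]
    free_subst_hom torus_simps)

section \<open>Rigidity of symmetries with sign weights\<close>

lemma uq_gens_carrier [simp]:
  "uq_k q \<in> carrier (uq q)" "uq_e q \<in> carrier (uq q)" "uq_f q \<in> carrier (uq q)"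
  by (auto simp: uq_k_def uq_e_def uq_f_def uq_simps)

lemma torus_gens_carrier [simp]:
  "torus_x q \<in> carrier (torus q)" "torus_y q \<in> carrier (torus q)"
  by (auto simp: torus_x_def torus_y_def torus_simps)

text \<open>
  The content of \<open>\<pi>\<close> being an algebra homomorphism into the endomorphism algebra, freed from
  restrictions and extensional composition.
\<close>

lemma symmetryD:
  assumes "symmetry q \<pi>" and h: "h \<in> carrier (uq q)" and a: "a \<in> carrier (torus q)"
  shows "\<pi> h a \<in> carrier (torus q)"
    and "b \<in> carrier (torus q) \<Longrightarrow> \<pi> h (a \<oplus>\<^bsub>torus q\<^esub> b) = \<pi> h a \<oplus>\<^bsub>torus q\<^esub> \<pi> h b"
    and "\<pi> h (c \<odot>\<^bsub>torus q\<^esub> a) = c \<odot>\<^bsub>torus q\<^esub> \<pi> h a"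
    and "h' \<in> carrier (uq q) \<Longrightarrow> \<pi> (h \<otimes>\<^bsub>uq q\<^esub> h') a = \<pi> h (\<pi> h' a)"
    and "h' \<in> carrier (uq q) \<Longrightarrow> \<pi> (h \<oplus>\<^bsub>uq q\<^esub> h') a = \<pi> h a \<oplus>\<^bsub>torus q\<^esub> \<pi> h' a"
    and "\<pi> (c \<odot>\<^bsub>uq q\<^esub> h) a = c \<odot>\<^bsub>torus q\<^esub> \<pi> h a"
    and "\<pi> \<one>\<^bsub>uq q\<^esub> a = a"
proof -
  have \<pi>: "\<pi> \<in> ring_hom (uq q) (end_alg (torus q))"
    "\<And>c h. h \<in> carrier (uq q) \<Longrightarrow> \<pi> (c \<odot>\<^bsub>uq q\<^esub> h) = c \<odot>\<^bsub>end_alg (torus q)\<^esub> \<pi> h"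
    using assms(1) by (auto simp: symmetry_def alg_hom_def)
  have c: "\<pi> h \<in> carrier (end_alg (torus q))" by (rule ring_hom_closed[OF \<pi>(1) h])
  show "\<pi> h a \<in> carrier (torus q)" "\<pi> h (c \<odot>\<^bsub>torus q\<^esub> a) = c \<odot>\<^bsub>torus q\<^esub> \<pi> h a"
    using c a by (auto simp: end_alg_def)
  show "\<pi> h (a \<oplus>\<^bsub>torus q\<^esub> b) = \<pi> h a \<oplus>\<^bsub>torus q\<^esub> \<pi> h b" if "b \<in> carrier (torus q)"
    using c a that by (auto simp: end_alg_def)
  show "\<pi> (h \<otimes>\<^bsub>uq q\<^esub> h') a = \<pi> h (\<pi> h' a)" if "h' \<in> carrier (uq q)"
    using ring_hom_mult[OF \<pi>(1) h that] a by (simp add: end_alg_def compose_def)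
  show "\<pi> (h \<oplus>\<^bsub>uq q\<^esub> h') a = \<pi> h a \<oplus>\<^bsub>torus q\<^esub> \<pi> h' a" if "h' \<in> carrier (uq q)"
    using ring_hom_add[OF \<pi>(1) h that] a by (simp add: end_alg_def)
  show "\<pi> (c \<odot>\<^bsub>uq q\<^esub> h) a = c \<odot>\<^bsub>torus q\<^esub> \<pi> h a"
    using \<pi>(2)[OF h] a by (simp add: end_alg_def)
  show "\<pi> \<one>\<^bsub>uq q\<^esub> a = a"
    using ring_hom_one[OF \<pi>(1)] a by (simp add: end_alg_def)
qed

lemma symmetry_extensional:
  assumes "symmetry q \<pi>"
  shows "\<pi> \<in> extensional (carrier (uq q))"
    and "h \<in> carrier (uq q) \<Longrightarrow> \<pi> h \<in> extensional (carrier (torus q))"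
proof -
  show "\<pi> \<in> extensional (carrier (uq q))" using assms by (simp add: symmetry_def)
  assume h: "h \<in> carrier (uq q)"
  have "\<pi> \<in> ring_hom (uq q) (end_alg (torus q))"
    using assms by (simp add: symmetry_def alg_hom_def)
  from ring_hom_closed[OF this h] show "\<pi> h \<in> extensional (carrier (torus q))"
    by (simp add: end_alg_def PiE_def)
qed

lemma torus_smult_simps:
  "a \<in> carrier (torus q) \<Longrightarrow> c \<odot>\<^bsub>torus q\<^esub> (d \<odot>\<^bsub>torus q\<^esub> a) = (c * d) \<odot>\<^bsub>torus q\<^esub> a"
  "a \<in> carrier (torus q) \<Longrightarrow> 1 \<odot>\<^bsub>torus q\<^esub> a = a"
  "a \<in> carrier (torus q) \<Longrightarrow> c \<odot>\<^bsub>torus q\<^esub> a \<in> carrier (torus q)"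
  "c \<odot>\<^bsub>torus q\<^esub> \<zero>\<^bsub>torus q\<^esub> = \<zero>\<^bsub>torus q\<^esub>"
  by (auto simp: torus_simps scalar_simps)

text \<open>
  The comultiplication of \<open>k\<close> is the single tensor \<open>k \<otimes> k\<close>, so its Sweedler sum has one term.
\<close>

lemma symmetry_k_alg_hom:
  assumes s: "symmetry q \<pi>" and q: "q \<noteq> 0"
  shows "\<pi> (uq_k q) \<in> alg_hom (torus q) (torus q)"
proof -
  interpret T: ring "torus q" by (rule ring_torus)
  have "tensor (gen K) (gen K) \<in> uq_comult q (uq_k q)"
    by (simp add: uq_k_def uq_comult_class[OF q] free_comult_hom uq_ideal2_def coset_self[OF ideal_Idl])
  then have m: "\<pi> (uq_k q) (a \<otimes>\<^bsub>torus q\<^esub> b) = tensor_act q \<pi> (tensor (gen K) (gen K)) a b"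
    if "a \<in> carrier (torus q)" "b \<in> carrier (torus q)" for a b
    using s that by (auto simp: symmetry_def)
  have t: "tensor_act q \<pi> (tensor (gen K) (gen K)) a b = \<pi> (uq_k q) a \<otimes>\<^bsub>torus q\<^esub> \<pi> (uq_k q) b"
    if ab: "a \<in> carrier (torus q)" "b \<in> carrier (torus q)" for a b
  proof -
    have "tensor (gen K) (gen K) = Poly_Mapping.single ([K], [K]) 1"
      by (simp add: gen_def word_def tensor_single)
    moreover have c: "\<pi> (uq_k q) a \<otimes>\<^bsub>torus q\<^esub> \<pi> (uq_k q) b \<in> carrier (torus q)"
      by (intro T.m_closed symmetryD(1)[OF s] uq_gens_carrier ab)
    ultimately show ?thesis
      using torus_smult_simps(2)[OF c]
      by (simp add: tensor_act_def uq_k_def gen_def T.finsum_insert)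
  qed
  have "\<pi> (uq_k q) \<one>\<^bsub>torus q\<^esub> = uq_counit (uq_k q) \<odot>\<^bsub>torus q\<^esub> \<one>\<^bsub>torus q\<^esub>"
    using s by (auto simp: symmetry_def)
  then have "\<pi> (uq_k q) \<one>\<^bsub>torus q\<^esub> = \<one>\<^bsub>torus q\<^esub>"
    by (simp add: uq_k_def uq_counit_class free_counit_hom torus_simps)
  then show ?thesis
    using symmetryD(1-3)[OF s uq_gens_carrier(1)] m t by (auto simp: alg_hom_def intro!: ring_hom_memI)
qed

lemma alg_hom_id: "(\<lambda>a. a) \<in> alg_hom M M"
  by (auto simp: alg_hom_def ring_hom_def)

lemma alg_hom_comp:
  assumes "f \<in> alg_hom M N" "g \<in> alg_hom N L"
  shows "(\<lambda>a. g (f a)) \<in> alg_hom M L"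
  using assms by (auto simp: alg_hom_def ring_hom_def Pi_iff)

lemma alg_hom_smult: "f \<in> alg_hom M N \<Longrightarrow> a \<in> carrier M \<Longrightarrow> f (c \<odot>\<^bsub>M\<^esub> a) = c \<odot>\<^bsub>N\<^esub> f a"
  by (auto simp: alg_hom_def)

lemma alg_hom_add:
  "f \<in> alg_hom M N \<Longrightarrow> a \<in> carrier M \<Longrightarrow> b \<in> carrier M \<Longrightarrow> f (a \<oplus>\<^bsub>M\<^esub> b) = f a \<oplus>\<^bsub>N\<^esub> f b"
  by (auto simp: alg_hom_def ring_hom_def)

lemma alg_hom_closed: "f \<in> alg_hom M N \<Longrightarrow> a \<in> carrier M \<Longrightarrow> f a \<in> carrier N"
  by (auto simp: alg_hom_def ring_hom_def)

lemma torus_hom_zero: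
  assumes "f \<in> alg_hom (torus q) (torus q)"
  shows "f \<zero>\<^bsub>torus q\<^esub> = \<zero>\<^bsub>torus q\<^esub>"
  using alg_hom_smult[OF assms, of "\<zero>\<^bsub>torus q\<^esub>" 0] alg_hom_closed[OF assms, of "\<zero>\<^bsub>torus q\<^esub>"]
  by (auto simp: torus_simps)

locale sign_weights =
  fixes q :: complex and \<pi> and \<alpha> \<beta> :: complex
  assumes q: "q \<noteq> 0" and q4: "q ^ 4 \<noteq> 1"
    and symmetry: "symmetry q \<pi>"
    and weights: "weight_constants q \<pi> \<alpha> \<beta>"
    and signs: "\<alpha> * \<alpha> = 1" "\<beta> * \<beta> = 1"
begin

lemmas D = symmetryD[OF symmetry]

lemma k_k:
  assumes a: "a \<in> carrier (torus q)"
  shows "\<pi> (uq_k q) (\<pi> (uq_k q) a) = a"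
  by (rule torus_hom_eqI[OF alg_hom_comp alg_hom_id _ _ a])
    (use weights signs in \<open>auto simp: weight_constants_def D torus_smult_simps
      intro: symmetry_k_alg_hom[OF symmetry q]\<close>)

text \<open>
  Moving both factors of \<open>\<pi>(k)\<^sup>2 = 1\<close> past \<open>\<pi>(h)\<close> gives \<open>\<pi>(h) = c\<^sup>2 \<pi>(h)\<close>. This applies to \<open>e\<close> with
  \<open>c = q\<^sup>2\<close> and to \<open>f\<close> with \<open>c = q\<^sup>-\<^sup>2\<close>.
\<close>

lemma k_eigenvector_zero:
  assumes h: "h \<in> carrier (uq q)" and kh: "uq_k q \<otimes>\<^bsub>uq q\<^esub> h = c \<odot>\<^bsub>uq q\<^esub> (h \<otimes>\<^bsub>uq q\<^esub> uq_k q)"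
    and c: "c * c \<noteq> 1" and a: "a \<in> carrier (torus q)"
  shows "\<pi> h a = \<zero>\<^bsub>torus q\<^esub>"
proof -
  interpret U: ring "uq q" unfolding uq_def by (rule ring_quot_alg[OF uq_ideal])
  have move: "\<pi> (uq_k q) (\<pi> h b) = c \<odot>\<^bsub>torus q\<^esub> \<pi> h (\<pi> (uq_k q) b)"
    if "b \<in> carrier (torus q)" for b
    using that h arg_cong[OF kh, of "\<lambda>h. \<pi> h b"] by (simp add: D)
  have "\<pi> h a = \<pi> (uq_k q) (\<pi> (uq_k q) (\<pi> h a))"
    using h a by (simp add: k_k D)
  also have "\<dots> = (c * c) \<odot>\<^bsub>torus q\<^esub> \<pi> h a"
    using h a by (simp add: move D k_k torus_smult_simps)
  finally show ?thesis using h a c by (intro torus_smult_cancel[of _ _ "c * c"]) (auto simp: D)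
qed

lemma e_zero: "a \<in> carrier (torus q) \<Longrightarrow> \<pi> (uq_e q) a = \<zero>\<^bsub>torus q\<^esub>"
proof (rule k_eigenvector_zero[where c = "q\<^sup>2"])
  show "uq_k q \<otimes>\<^bsub>uq q\<^esub> uq_e q = q\<^sup>2 \<odot>\<^bsub>uq q\<^esub> (uq_e q \<otimes>\<^bsub>uq q\<^esub> uq_k q)"
    unfolding uq_k_def uq_e_def uq_simps by (rule uq_rel) (simp add: uq_rels_def mult.assoc)
qed (use q4 in \<open>auto simp flip: power_add\<close>)

lemma f_zero: "a \<in> carrier (torus q) \<Longrightarrow> \<pi> (uq_f q) a = \<zero>\<^bsub>torus q\<^esub>"
proof (rule k_eigenvector_zero[where c = "inverse (q\<^sup>2)"])
  show "uq_k q \<otimes>\<^bsub>uq q\<^esub> uq_f q = inverse (q\<^sup>2) \<odot>\<^bsub>uq q\<^esub> (uq_f q \<otimes>\<^bsub>uq q\<^esub> uq_k q)"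
    unfolding uq_k_def uq_f_def uq_simps by (rule uq_rel) (simp add: uq_rels_def mult.assoc)
  have "inverse (q\<^sup>2) * inverse (q\<^sup>2) = inverse (q ^ 4)"
    by (simp flip: power_add inverse_mult_distrib)
  then show "inverse (q\<^sup>2) * inverse (q\<^sup>2) \<noteq> 1" using q4 by simp
qed auto

lemma k'_eq_k:
  assumes a: "a \<in> carrier (torus q)"
  shows "\<pi> (uq_class q (gen K')) a = \<pi> (uq_k q) a"
proof -
  have c: "uq_class q (gen K') \<in> carrier (uq q)" by (simp add: uq_simps)
  have "uq_class q (gen K') \<otimes>\<^bsub>uq q\<^esub> uq_k q = \<one>\<^bsub>uq q\<^esub>"
    unfolding uq_k_def uq_simps by (rule uq_rel) (simp add: uq_rels_def)
  moreover have "\<pi> (uq_class q (gen K') \<otimes>\<^bsub>uq q\<^esub> uq_k q) (\<pi> (uq_k q) a) = \<pi> (uq_class q (gen K')) a"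
    using a c by (simp add: D k_k)
  ultimately show ?thesis using D(7)[OF c D(1)[OF uq_gens_carrier(1) a]] by simp
qed

end

text \<open>
  Since \<open>e\<close> and \<open>f\<close> act as zero and \<open>k\<^sup>-\<^sup>1\<close> acts like \<open>k\<close>, compatibility with \<open>k\<close> is all there is
  to check, and \<open>k\<close> acts by algebra endomorphisms, so it can be tested on \<open>x\<close> and \<open>y\<close>. With the
  identity for \<open>\<Psi>\<close> this is the uniqueness of a symmetry with given signs; with an automorphism it
  produces isomorphisms.
\<close>

lemma intertwine:
  assumes 1: "sign_weights q \<pi> \<alpha> \<beta>" and 2: "sign_weights q \<pi>' \<alpha>' \<beta>'"
    and \<Psi>: "\<Psi> \<in> alg_hom (torus q) (torus q)"
    and x: "\<Psi> (\<pi> (uq_k q) (torus_x q)) = \<pi>' (uq_k q) (\<Psi> (torus_x q))"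
    and y: "\<Psi> (\<pi> (uq_k q) (torus_y q)) = \<pi>' (uq_k q) (\<Psi> (torus_y q))"
    and h: "h \<in> carrier (uq q)" and a: "a \<in> carrier (torus q)"
  shows "\<Psi> (\<pi> h a) = \<pi>' h (\<Psi> a)"
proof -
  interpret P: sign_weights q \<pi> \<alpha> \<beta> by (rule 1)
  interpret P': sign_weights q \<pi>' \<alpha>' \<beta>' by (rule 2)
  have k: "\<Psi> (\<pi> (uq_k q) a) = \<pi>' (uq_k q) (\<Psi> a)" if "a \<in> carrier (torus q)" for a
  proof -
    have "(\<lambda>a. \<Psi> (\<pi> (uq_k q) a)) \<in> alg_hom (torus q) (torus q)"
      by (rule alg_hom_comp[OF symmetry_k_alg_hom[OF P.symmetry P.q] \<Psi>])
    moreover have "(\<lambda>a. \<pi>' (uq_k q) (\<Psi> a)) \<in> alg_hom (torus q) (torus q)"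
      by (rule alg_hom_comp[OF \<Psi> symmetry_k_alg_hom[OF P'.symmetry P.q]])
    ultimately show ?thesis using x y that by (rule torus_hom_eqI)
  qed
  note c = alg_hom_closed[OF \<Psi>]
  from h have "\<forall>a\<in>carrier (torus q). \<Psi> (\<pi> h a) = \<pi>' h (\<Psi> a)"
  proof (induct rule: uq_induct)
    case (gen g)
    show ?case
      using k P.k'_eq_k P'.k'_eq_k P.e_zero P'.e_zero P.f_zero P'.f_zero c torus_hom_zero[OF \<Psi>]
      by (cases g) (auto simp: uq_k_def uq_e_def uq_f_def)
  next
    case (smult c h)
    then show ?case using \<Psi> c by (simp add: P.D P'.D alg_hom_smult)
  next
    case one
    interpret U: ring "uq q" unfolding uq_def by (rule ring_quot_alg[OF uq_ideal])
    show ?case using c by (simp add: P.D(7)[of "\<one>\<^bsub>uq q\<^esub>"] P'.D(7)[of "\<one>\<^bsub>uq q\<^esub>"])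
  next
    case (add g h)
    then show ?case using c by (simp add: P.D P'.D alg_hom_add[OF \<Psi>])
  next
    case (mult g h)
    then show ?case using c by (simp add: P.D P'.D)
  qed
  with a show ?thesis by blast
qed

lemma sign_weights_unique:
  assumes 1: "sign_weights q \<pi> \<alpha> \<beta>" and 2: "sign_weights q \<pi>' \<alpha> \<beta>"
  shows "\<pi> = \<pi>'"
proof -
  interpret P: sign_weights q \<pi> \<alpha> \<beta> by (rule 1)
  interpret P': sign_weights q \<pi>' \<alpha> \<beta> by (rule 2)
  have e: "\<pi> h a = \<pi>' h a" if "h \<in> carrier (uq q)" "a \<in> carrier (torus q)" for h a
    by (rule intertwine[OF 1 2 alg_hom_id _ _ that])
      (use P.weights P'.weights in \<open>auto simp: weight_constants_def\<close>)
  show ?thesis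
  proof (rule extensionalityI[OF symmetry_extensional(1)[OF P.symmetry] symmetry_extensional(1)[OF P'.symmetry]])
    fix h assume h: "h \<in> carrier (uq q)"
    show "\<pi> h = \<pi>' h"
      by (rule extensionalityI[OF symmetry_extensional(2)[OF P.symmetry h] symmetry_extensional(2)[OF P'.symmetry h]])
        (rule e[OF h])
  qed
qed

lemma sign_weights_sign_symmetry:
  assumes "q \<noteq> 0" "q ^ 4 \<noteq> 1" "\<alpha> * \<alpha> = 1" "\<beta> * \<beta> = 1"
  shows "sign_weights q (sign_symmetry \<alpha> \<beta> q) \<alpha> \<beta>"
  using assms by unfold_locales (auto simp: symmetry_sign_symmetry weight_constants_sign_symmetry)

text \<open>
  The class of a generator is a basis monomial, so its scalar multiples are distinct.
\<close>

lemma weight_constants_unique: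
  assumes q: "q \<noteq> 0" and "weight_constants q \<pi> \<alpha> \<beta>" "weight_constants q \<pi> \<alpha>' \<beta>'"
  shows "\<alpha> = \<alpha>'" "\<beta> = \<beta>'"
proof -
  have e: "c = c'" if "torus_class q (scalar c * gen g) = torus_class q (scalar c' * gen g)" for c c' g
  proof -
    have "normal_form q (scalar c * gen g) = Poly_Mapping.single (gen_degree g) c" for c
      by (simp add: gen_def word_def mult_single normal_form_single)
    then show ?thesis using that unfolding torus_class_eq_iff_normal_form[OF q]
      by (metis lookup_single_eq)
  qed
  show "\<alpha> = \<alpha>'" "\<beta> = \<beta>'"
    using assms(2,3) by (auto simp: weight_constants_def torus_x_def torus_y_def torus_simps intro: e)
qed

section \<open>Isomorphisms\<close>

text \<open>
  The form without the inverse of \<open>\<Psi>\<close> composes more easily.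
\<close>

lemma symmetry_iso_iff:
  "(\<pi>\<^sub>1, \<pi>\<^sub>2) \<in> symmetry_iso q \<longleftrightarrow> symmetry q \<pi>\<^sub>1 \<and> symmetry q \<pi>\<^sub>2 \<and>
     (\<exists>\<Psi>\<in>alg_auto (torus q). \<forall>h\<in>carrier (uq q). \<forall>a\<in>carrier (torus q).
        \<Psi> (\<pi>\<^sub>1 h a) = \<pi>\<^sub>2 h (\<Psi> a))"
proof -
  have "(\<forall>a\<in>carrier (torus q). \<Psi> (\<pi>\<^sub>1 h (inv_into (carrier (torus q)) \<Psi> a)) = \<pi>\<^sub>2 h a) \<longleftrightarrow>
      (\<forall>a\<in>carrier (torus q). \<Psi> (\<pi>\<^sub>1 h a) = \<pi>\<^sub>2 h (\<Psi> a))"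
    if "\<Psi> \<in> alg_auto (torus q)" for \<Psi> h
  proof -
    have inj: "inj_on \<Psi> (carrier (torus q))" and surj: "\<Psi> ` carrier (torus q) = carrier (torus q)"
      using that by (auto simp: alg_auto_def bij_betw_def)
    have "(\<forall>a\<in>carrier (torus q). \<Psi> (\<pi>\<^sub>1 h (inv_into (carrier (torus q)) \<Psi> a)) = \<pi>\<^sub>2 h a) \<longleftrightarrow>
        (\<forall>a\<in>\<Psi> ` carrier (torus q). \<Psi> (\<pi>\<^sub>1 h (inv_into (carrier (torus q)) \<Psi> a)) = \<pi>\<^sub>2 h a)"
      by (simp only: surj)
    also have "\<dots> \<longleftrightarrow> (\<forall>a\<in>carrier (torus q). \<Psi> (\<pi>\<^sub>1 h a) = \<pi>\<^sub>2 h (\<Psi> a))"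
      by (simp add: inv_into_f_f[OF inj])
    finally show ?thesis .
  qed
  then show ?thesis by (auto simp: symmetry_iso_def)
qed

lemma symmetry_iso_refl: "symmetry q \<pi> \<Longrightarrow> (\<pi>, \<pi>) \<in> symmetry_iso q"
  unfolding symmetry_iso_iff
  by (intro conjI bexI[of _ "\<lambda>a. a"])
    (simp_all add: alg_auto_def alg_hom_id bij_betw_def inj_on_def)

lemma symmetry_iso_trans:
  assumes "(\<pi>\<^sub>1, \<pi>\<^sub>2) \<in> symmetry_iso q" "(\<pi>\<^sub>2, \<pi>\<^sub>3) \<in> symmetry_iso q"
  shows "(\<pi>\<^sub>1, \<pi>\<^sub>3) \<in> symmetry_iso q"
proof -
  obtain \<Psi> \<Phi> where *: "\<Psi> \<in> alg_auto (torus q)" "\<Phi> \<in> alg_auto (torus q)"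
    "\<And>h a. h \<in> carrier (uq q) \<Longrightarrow> a \<in> carrier (torus q) \<Longrightarrow> \<Psi> (\<pi>\<^sub>1 h a) = \<pi>\<^sub>2 h (\<Psi> a)"
    "\<And>h a. h \<in> carrier (uq q) \<Longrightarrow> a \<in> carrier (torus q) \<Longrightarrow> \<Phi> (\<pi>\<^sub>2 h a) = \<pi>\<^sub>3 h (\<Phi> a)"
    using assms unfolding symmetry_iso_iff by blast
  have "(\<lambda>a. \<Phi> (\<Psi> a)) \<in> alg_auto (torus q)"
    using * bij_betw_trans[of \<Psi> _ _ \<Phi>] by (auto simp: alg_auto_def o_def intro: alg_hom_comp)
  moreover have "\<Psi> a \<in> carrier (torus q)" if "a \<in> carrier (torus q)" for a
    using *(1) that by (auto simp: alg_auto_def intro: alg_hom_closed)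
  ultimately show ?thesis
    using assms * unfolding symmetry_iso_iff by (intro conjI bexI[of _ "\<lambda>a. \<Phi> (\<Psi> a)"]) auto
qed

text \<open>
  On exponents this automorphism is a matrix of order three in \<open>SL\<^sub>2(\<int>)\<close>, which permutes the three
  nonzero elements of \<open>(\<int>/2)\<^sup>2\<close> and hence the three nontrivial pairs of signs. The powers of
  \<open>q\<close> cancel in its cube, which is exactly the identity, so its square is its inverse.
\<close>

fun cycle_gen :: "torus_gen \<Rightarrow> torus_gen free" where
  "cycle_gen X = gen Y"
| "cycle_gen X' = gen Y'"
| "cycle_gen Y = gen X' * gen Y'"
| "cycle_gen Y' = gen Y * gen X"

lemma normal_form_gens:
  "normal_form q (gen g) = Poly_Mapping.single (gen_degree g) 1"
  by (simp add: gen_def word_def normal_form_single)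

lemma normal_form_scalar:
  "normal_form q (scalar c) = Poly_Mapping.single 0 c"
proof -
  have 1: "(scalar c :: torus_gen free) = Poly_Mapping.single [] c" by (simp flip: zero_list_def)
  show ?thesis unfolding 1 normal_form_single by simp
qed

lemmas normal_form_calc = normal_form_gens normal_form_scalar normal_form_1 normal_form_diff
  normal_form_mult twisted_mult_single zero_prod_def

lemma cycle_gen_torus_ideal:
  assumes "q \<noteq> 0" "r \<in> torus_rels q"
  shows "free_subst cycle_gen r \<in> torus_ideal q"
  using assms
  by (auto simp: torus_rels_def free_subst_hom torus_ideal_iff normal_form_calc)

lemma cycle_alg_auto:
  assumes q: "q \<noteq> 0"
  shows "torus_map q cycle_gen \<in> alg_auto (torus q)"
proof -
  let ?\<Psi> = "torus_map q cycle_gen"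
  have hom: "?\<Psi> \<in> alg_hom (torus q) (torus q)"
    by (rule torus_map_alg_hom) (rule cycle_gen_torus_ideal[OF q])
  have cycle_class: "?\<Psi> (torus_class q p) = torus_class q (free_subst cycle_gen p)" for p
    by (rule torus_map_class) (rule cycle_gen_torus_ideal[OF q])
  have 3: "?\<Psi> (?\<Psi> (?\<Psi> a)) = a" if "a \<in> carrier (torus q)" for a
    by (rule torus_hom_eqI[OF alg_hom_comp[OF hom alg_hom_comp[OF hom hom]] alg_hom_id _ _ that])
      (simp_all add: torus_x_def torus_y_def cycle_class free_subst_hom
        torus_class_eq_iff_normal_form[OF q] normal_form_calc q)
  have "bij_betw ?\<Psi> (carrier (torus q)) (carrier (torus q))"
    by (rule bij_betw_byWitness[where f' = "\<lambda>a. ?\<Psi> (?\<Psi> a)"])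
      (use 3 alg_hom_closed[OF hom] in auto)
  then show ?thesis using hom by (simp add: alg_auto_def)
qed

text \<open>
  The new signs \<open>(\<alpha>', \<beta>')\<close> are determined by \<open>\<beta>' = \<alpha>\<close>, from the image \<open>y\<close> of \<open>x\<close>, and
  \<open>\<alpha>'\<beta>' = \<beta>\<close>, from the image \<open>x\<^sup>-\<^sup>1 y\<^sup>-\<^sup>1\<close> of \<open>y\<close>.
\<close>

lemma sign_symmetry_iso_cycle:
  assumes q: "q \<noteq> 0" "q ^ 4 \<noteq> 1" and \<alpha>: "\<alpha> \<in> {-1, 1}" and \<beta>: "\<beta> \<in> {-1, 1}"
  shows "(sign_symmetry \<alpha> \<beta> q, sign_symmetry (\<alpha> * \<beta>) \<alpha> q) \<in> symmetry_iso q"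
proof -
  have s: "\<alpha> * \<alpha> = 1" "\<beta> * \<beta> = 1" "(\<alpha> * \<beta>) * (\<alpha> * \<beta>) = 1" using \<alpha> \<beta> by auto
  have cycle_class: "torus_map q cycle_gen (torus_class q p) = torus_class q (free_subst cycle_gen p)" for p
    by (rule torus_map_class) (rule cycle_gen_torus_ideal[OF q(1)])
  have auto: "torus_map q cycle_gen \<in> alg_auto (torus q)" by (rule cycle_alg_auto[OF q(1)])
  have "torus_map q cycle_gen (sign_symmetry \<alpha> \<beta> q h a) =
      sign_symmetry (\<alpha> * \<beta>) \<alpha> q h (torus_map q cycle_gen a)"
    if "h \<in> carrier (uq q)" "a \<in> carrier (torus q)" for h a
  proof (rule intertwine[OF sign_weights_sign_symmetry[OF q s(1,2)]
        sign_weights_sign_symmetry[OF q s(3,1)] _ _ _ that])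
    show "torus_map q cycle_gen \<in> alg_hom (torus q) (torus q)" using auto by (simp add: alg_auto_def)
  qed (use \<alpha> \<beta> in \<open>auto simp: q s sign_symmetry_k torus_x_def torus_y_def
      cycle_class free_subst_hom torus_class_eq_iff_normal_form normal_form_calc\<close>)
  then show ?thesis
    using auto symmetry_sign_symmetry s q(1) by (auto simp: symmetry_iso_iff)
qed

text \<open>
  A unit is a single monomial, hence an eigenvector of the diagonal map \<open>\<pi>\<^sub>1(k)\<close>. Isomorphisms
  carry units to units, so \<open>x\<close> and \<open>y\<close> are eigenvectors of \<open>\<pi>\<^sub>2(k)\<close>.
\<close>

lemma symmetry_iso_unit_eigenvector:
  assumes 1: "sign_weights q \<pi>\<^sub>1 \<alpha> \<beta>" and signs: "\<alpha> \<in> {-1, 1}" "\<beta> \<in> {-1, 1}"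
    and iso: "(\<pi>\<^sub>1, \<pi>\<^sub>2) \<in> symmetry_iso q"
    and u: "u \<in> carrier (torus q)" "v \<in> carrier (torus q)" "u \<otimes>\<^bsub>torus q\<^esub> v = \<one>\<^bsub>torus q\<^esub>"
  shows "\<exists>s\<in>{-1, 1}. \<pi>\<^sub>2 (uq_k q) u = s \<odot>\<^bsub>torus q\<^esub> u"
proof -
  interpret P: sign_weights q \<pi>\<^sub>1 \<alpha> \<beta> by (rule 1)
  have \<pi>\<^sub>1: "\<pi>\<^sub>1 = sign_symmetry \<alpha> \<beta> q"
    by (intro sign_weights_unique[OF 1] sign_weights_sign_symmetry P.q P.q4 P.signs)
  obtain \<Psi> where \<Psi>: "\<Psi> \<in> alg_auto (torus q)"
    "\<And>h a. h \<in> carrier (uq q) \<Longrightarrow> a \<in> carrier (torus q) \<Longrightarrow> \<Psi> (\<pi>\<^sub>1 h a) = \<pi>\<^sub>2 h (\<Psi> a)"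
    using iso unfolding symmetry_iso_iff by blast
  have hom: "\<Psi> \<in> alg_hom (torus q) (torus q)" and rhom: "\<Psi> \<in> ring_hom (torus q) (torus q)"
    and inj: "inj_on \<Psi> (carrier (torus q))" and surj: "\<Psi> ` carrier (torus q) = carrier (torus q)"
    using \<Psi>(1) by (auto simp: alg_auto_def alg_hom_def bij_betw_def)
  have pre: "\<exists>p. \<Psi> (torus_class q p) = a" if "a \<in> carrier (torus q)" for a
  proof -
    have "a \<in> \<Psi> ` range (torus_class q)" using that surj unfolding torus_simps(1) by simp
    then show ?thesis by blast
  qed
  obtain p r where p: "\<Psi> (torus_class q p) = u" and r: "\<Psi> (torus_class q r) = v"
    using pre[OF u(1)] pre[OF u(2)] by blast
  have "\<Psi> (torus_class q p \<otimes>\<^bsub>torus q\<^esub> torus_class q r) = \<Psi> \<one>\<^bsub>torus q\<^esub>"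
    using ring_hom_mult[OF rhom] ring_hom_one[OF rhom] u(3) p r by (simp add: torus_simps(1))
  then have "\<Psi> (torus_class q (p * r)) = \<Psi> (torus_class q 1)" by (simp add: torus_simps)
  then have "torus_class q (p * r) = torus_class q 1"
    using inj by (auto simp: inj_on_def torus_simps)
  then obtain d c where nf: "normal_form q p = Poly_Mapping.single d c"
    using torus_unit_monomial[OF P.q] by blast
  define s where "s = weight \<alpha> \<beta> d"
  have s: "s \<in> {-1, 1}"
    using weight_square[OF P.signs, of d] by (auto simp: s_def square_eq_1_iff)
  have "\<pi>\<^sub>1 (uq_k q) (torus_class q p) = s \<odot>\<^bsub>torus q\<^esub> torus_class q p"
    using normal_form_rescale[OF _ _ nf, of \<alpha> \<beta>] signs
    by (auto simp: \<pi>\<^sub>1 sign_symmetry_k[OF P.signs P.q] torus_simps torus_class_eq_iff_normal_form[OF P.q]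
      normal_form_mult[OF P.q] normal_form_scalar nf twisted_mult_single s_def)
  then have "\<pi>\<^sub>2 (uq_k q) u = s \<odot>\<^bsub>torus q\<^esub> u"
    using \<Psi>(2)[of "uq_k q" "torus_class q p"] alg_hom_smult[OF hom, of "torus_class q p" s]
    by (simp add: p torus_simps(1))
  with s show ?thesis by blast
qed

text \<open>
  The last conclusion holds because a conjugate of the identity is the identity, and both weights
  are \<open>1\<close> exactly when \<open>k\<close> acts as the identity.
\<close>

lemma symmetry_iso_sign_weights:
  assumes 1: "sign_weights q \<pi>\<^sub>1 \<alpha> \<beta>" and signs: "\<alpha> \<in> {-1, 1}" "\<beta> \<in> {-1, 1}"
    and iso: "(\<pi>\<^sub>1, \<pi>\<^sub>2) \<in> symmetry_iso q"
  obtains \<alpha>' \<beta>' where "\<alpha>' \<in> {-1, 1}" "\<beta>' \<in> {-1, 1}" "sign_weights q \<pi>\<^sub>2 \<alpha>' \<beta>'"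
    "\<alpha>' = 1 \<and> \<beta>' = 1 \<longleftrightarrow> \<alpha> = 1 \<and> \<beta> = 1"
proof -
  interpret P: sign_weights q \<pi>\<^sub>1 \<alpha> \<beta> by (rule 1)
  note u = symmetry_iso_unit_eigenvector[OF assms]
  obtain \<alpha>' where \<alpha>': "\<alpha>' \<in> {-1, 1}" "\<pi>\<^sub>2 (uq_k q) (torus_x q) = \<alpha>' \<odot>\<^bsub>torus q\<^esub> torus_x q"
  proof -
    have "\<exists>s\<in>{-1, 1}. \<pi>\<^sub>2 (uq_k q) (torus_x q) = s \<odot>\<^bsub>torus q\<^esub> torus_x q"
      by (rule u[of _ "torus_class q (gen X')"])
        (simp_all add: torus_x_def torus_simps torus_class_rels(2))
    then show thesis using that by blast
  qed
  obtain \<beta>' where \<beta>': "\<beta>' \<in> {-1, 1}" "\<pi>\<^sub>2 (uq_k q) (torus_y q) = \<beta>' \<odot>\<^bsub>torus q\<^esub> torus_y q"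
  proof -
    have "\<exists>s\<in>{-1, 1}. \<pi>\<^sub>2 (uq_k q) (torus_y q) = s \<odot>\<^bsub>torus q\<^esub> torus_y q"
      by (rule u[of _ "torus_class q (gen Y')"])
        (simp_all add: torus_y_def torus_simps torus_class_rels(4))
    then show thesis using that by blast
  qed
  have s2: "symmetry q \<pi>\<^sub>2" using iso by (simp add: symmetry_iso_iff)
  have w2: "weight_constants q \<pi>\<^sub>2 \<alpha>' \<beta>'" using \<alpha>' \<beta>' by (auto simp: weight_constants_def)
  have 2: "sign_weights q \<pi>\<^sub>2 \<alpha>' \<beta>'"
    using P.q P.q4 s2 w2 \<alpha>'(1) \<beta>'(1) by unfold_locales auto
  obtain \<Psi> where \<Psi>: "\<Psi> \<in> alg_auto (torus q)"
    "\<And>h a. h \<in> carrier (uq q) \<Longrightarrow> a \<in> carrier (torus q) \<Longrightarrow> \<Psi> (\<pi>\<^sub>1 h a) = \<pi>\<^sub>2 h (\<Psi> a)"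
    using iso unfolding symmetry_iso_iff by blast
  have inj: "inj_on \<Psi> (carrier (torus q))" and surj: "\<Psi> ` carrier (torus q) = carrier (torus q)"
    using \<Psi>(1) by (auto simp: alg_auto_def bij_betw_def)
  have triv: "weight_constants q \<pi> 1 1 \<longleftrightarrow> (\<forall>a\<in>carrier (torus q). \<pi> (uq_k q) a = a)"
    if s: "symmetry q \<pi>" for \<pi>
  proof
    assume "weight_constants q \<pi> 1 1"
    then show "\<forall>a\<in>carrier (torus q). \<pi> (uq_k q) a = a"
      using torus_hom_eqI[OF symmetry_k_alg_hom[OF s P.q] alg_hom_id]
      by (auto simp: weight_constants_def torus_smult_simps)
  qed (auto simp: weight_constants_def torus_smult_simps)
  have "(\<forall>a\<in>carrier (torus q). \<pi>\<^sub>2 (uq_k q) a = a) \<longleftrightarrow>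
      (\<forall>a\<in>\<Psi> ` carrier (torus q). \<pi>\<^sub>2 (uq_k q) a = a)"
    by (simp only: surj)
  also have "\<dots> \<longleftrightarrow> (\<forall>a\<in>carrier (torus q). \<Psi> (\<pi>\<^sub>1 (uq_k q) a) = \<Psi> a)"
    using \<Psi>(2) by simp
  also have "\<dots> \<longleftrightarrow> (\<forall>a\<in>carrier (torus q). \<pi>\<^sub>1 (uq_k q) a = a)"
    by (intro ball_cong refl inj_on_eq_iff[OF inj] P.D(1) uq_gens_carrier)
  finally have "weight_constants q \<pi>\<^sub>2 1 1 \<longleftrightarrow> weight_constants q \<pi>\<^sub>1 1 1"
    by (simp add: triv[OF s2] triv[OF P.symmetry])
  then have "\<alpha>' = 1 \<and> \<beta>' = 1 \<longleftrightarrow> \<alpha> = 1 \<and> \<beta> = 1"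
    using weight_constants_unique[OF P.q w2] weight_constants_unique[OF P.q P.weights] w2 P.weights
    by metis
  with \<alpha>'(1) \<beta>'(1) 2 show thesis by (rule that)
qed

section \<open>The classification\<close>

theorem theorem3p3:
  fixes q :: complex
  assumes "q \<noteq> 0" and "\<forall>n::nat. n > 0 \<longrightarrow> q ^ n \<noteq> 1"
  shows
    "(\<forall>\<alpha>\<in>{-1, 1}. \<forall>\<beta>\<in>{-1, 1}. \<exists>!\<pi>. symmetry q \<pi> \<and>
        \<pi> (uq_k q) (torus_x q) = \<alpha> \<odot>\<^bsub>torus q\<^esub> torus_x q \<and>
        \<pi> (uq_k q) (torus_y q) = \<beta> \<odot>\<^bsub>torus q\<^esub> torus_y q \<and>
        \<pi> (uq_e q) (torus_x q) = \<zero>\<^bsub>torus q\<^esub> \<and> \<pi> (uq_e q) (torus_y q) = \<zero>\<^bsub>torus q\<^esub> \<and>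
        \<pi> (uq_f q) (torus_x q) = \<zero>\<^bsub>torus q\<^esub> \<and> \<pi> (uq_f q) (torus_y q) = \<zero>\<^bsub>torus q\<^esub>) \<and>
     sign_symmetries q =
       {\<pi>. symmetry q \<pi> \<and> (\<exists>\<alpha>\<in>{-1, 1}. \<exists>\<beta>\<in>{-1, 1}.
          \<pi> (uq_k q) (torus_x q) = \<alpha> \<odot>\<^bsub>torus q\<^esub> torus_x q \<and>
          \<pi> (uq_k q) (torus_y q) = \<beta> \<odot>\<^bsub>torus q\<^esub> torus_y q \<and>
          \<pi> (uq_e q) (torus_x q) = \<zero>\<^bsub>torus q\<^esub> \<and> \<pi> (uq_e q) (torus_y q) = \<zero>\<^bsub>torus q\<^esub> \<and>
          \<pi> (uq_f q) (torus_x q) = \<zero>\<^bsub>torus q\<^esub> \<and> \<pi> (uq_f q) (torus_y q) = \<zero>\<^bsub>torus q\<^esub>)} \<and>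
     card (sign_symmetries q) = 4 \<and>
     sign_symmetries q // symmetry_iso q =
       {{\<pi> \<in> sign_symmetries q. weight_constants q \<pi> 1 1},
        {\<pi> \<in> sign_symmetries q. \<not> weight_constants q \<pi> 1 1}} \<and>
     card (sign_symmetries q // symmetry_iso q) = 2 \<and>
     card {\<pi> \<in> sign_symmetries q. weight_constants q \<pi> 1 1} = 1 \<and>
     card {\<pi> \<in> sign_symmetries q. \<not> weight_constants q \<pi> 1 1} = 3"
proof -
  note q = assms(1)
  have q4: "q ^ 4 \<noteq> 1" using assms(2) by simp
  let ?S = "\<lambda>\<alpha> \<beta>. sign_symmetry \<alpha> \<beta> q"
  have S: "sign_weights q (?S \<alpha> \<beta>) \<alpha> \<beta>" if "\<alpha> \<in> {-1, 1}" "\<beta> \<in> {-1, 1}" for \<alpha> \<beta>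
    by (rule sign_weights_sign_symmetry[OF q q4]) (use that in auto)
  have sw: "sign_weights q \<pi> \<alpha> \<beta> \<longleftrightarrow> symmetry q \<pi> \<and> weight_constants q \<pi> \<alpha> \<beta>"
    if "\<alpha> \<in> {-1, 1}" "\<beta> \<in> {-1, 1}" for \<pi> \<alpha> \<beta>
    using that q q4 by (auto simp: sign_weights_def)
  have wc: "weight_constants q \<pi> \<alpha> \<beta> \<longleftrightarrow>
      \<pi> (uq_k q) (torus_x q) = \<alpha> \<odot>\<^bsub>torus q\<^esub> torus_x q \<and>
      \<pi> (uq_k q) (torus_y q) = \<beta> \<odot>\<^bsub>torus q\<^esub> torus_y q"
    if "\<alpha> \<in> {-1, 1}" "\<beta> \<in> {-1, 1}" for \<pi> \<alpha> \<beta>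
    using that by (auto simp: weight_constants_def)
  let ?given = "\<lambda>\<pi> \<alpha> \<beta>. \<pi> (uq_k q) (torus_x q) = \<alpha> \<odot>\<^bsub>torus q\<^esub> torus_x q \<and>
          \<pi> (uq_k q) (torus_y q) = \<beta> \<odot>\<^bsub>torus q\<^esub> torus_y q \<and>
          \<pi> (uq_e q) (torus_x q) = \<zero>\<^bsub>torus q\<^esub> \<and> \<pi> (uq_e q) (torus_y q) = \<zero>\<^bsub>torus q\<^esub> \<and>
          \<pi> (uq_f q) (torus_x q) = \<zero>\<^bsub>torus q\<^esub> \<and> \<pi> (uq_f q) (torus_y q) = \<zero>\<^bsub>torus q\<^esub>"
  have given: "symmetry q \<pi> \<and> ?given \<pi> \<alpha> \<beta> \<longleftrightarrow> sign_weights q \<pi> \<alpha> \<beta>"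
    if "\<alpha> \<in> {-1, 1}" "\<beta> \<in> {-1, 1}" for \<pi> \<alpha> \<beta>
    using sign_weights.e_zero[of q \<pi> \<alpha> \<beta>] sign_weights.f_zero[of q \<pi> \<alpha> \<beta>] sw[OF that] wc[OF that]
    by (auto simp del: insert_iff)
  have 1: "\<forall>\<alpha>\<in>{-1, 1}. \<forall>\<beta>\<in>{-1, 1}. \<exists>!\<pi>. symmetry q \<pi> \<and> ?given \<pi> \<alpha> \<beta>"
  proof (intro ballI)
    fix \<alpha> \<beta> :: complex assume \<alpha>\<beta>: "\<alpha> \<in> {-1, 1}" "\<beta> \<in> {-1, 1}"
    show "\<exists>!\<pi>. symmetry q \<pi> \<and> ?given \<pi> \<alpha> \<beta>"
      unfolding given[OF \<alpha>\<beta>] using S[OF \<alpha>\<beta>] sign_weights_unique by blast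
  qed
  have mem: "\<pi> \<in> sign_symmetries q \<longleftrightarrow> (\<exists>\<alpha>\<in>{-1, 1}. \<exists>\<beta>\<in>{-1, 1}. sign_weights q \<pi> \<alpha> \<beta>)" for \<pi>
    unfolding sign_symmetries_def using sw by blast
  have 2: "sign_symmetries q = {\<pi>. symmetry q \<pi> \<and> (\<exists>\<alpha>\<in>{-1, 1}. \<exists>\<beta>\<in>{-1, 1}. ?given \<pi> \<alpha> \<beta>)}"
  proof (rule Set.set_eqI)
    fix \<pi>
    have pull: "(\<exists>\<alpha>\<in>A. \<exists>\<beta>\<in>A. P \<and> R \<alpha> \<beta>) \<longleftrightarrow> P \<and> (\<exists>\<alpha>\<in>A. \<exists>\<beta>\<in>A. R \<alpha> \<beta>)"
      for A :: "complex set" and P R by blast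
    have "\<pi> \<in> sign_symmetries q \<longleftrightarrow>
        (\<exists>\<alpha>\<in>{-1, 1}. \<exists>\<beta>\<in>{-1, 1}. symmetry q \<pi> \<and> ?given \<pi> \<alpha> \<beta>)"
      unfolding mem by (intro bex_cong refl given[symmetric])
    then show "\<pi> \<in> sign_symmetries q \<longleftrightarrow>
        \<pi> \<in> {\<pi>. symmetry q \<pi> \<and> (\<exists>\<alpha>\<in>{-1, 1}. \<exists>\<beta>\<in>{-1, 1}. ?given \<pi> \<alpha> \<beta>)}"
      unfolding pull mem_Collect_eq .
  qed
  have eq: "sign_weights q \<pi> \<alpha> \<beta> \<longleftrightarrow> \<pi> = ?S \<alpha> \<beta>" if "\<alpha> \<in> {-1, 1}" "\<beta> \<in> {-1, 1}" for \<pi> \<alpha> \<beta>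
    using S[OF that] sign_weights_unique by blast
  have all: "sign_symmetries q = {?S 1 1, ?S 1 (-1), ?S (-1) 1, ?S (-1) (-1)}"
    using mem eq by auto
  have inj: "?S \<alpha> \<beta> = ?S \<alpha>' \<beta>' \<longleftrightarrow> \<alpha> = \<alpha>' \<and> \<beta> = \<beta>'"
    if "\<alpha> \<in> {-1, 1}" "\<beta> \<in> {-1, 1}" "\<alpha>' \<in> {-1, 1}" "\<beta>' \<in> {-1, 1}" for \<alpha> \<beta> \<alpha>' \<beta>'
    using weight_constants_unique[OF q] S[OF that(1,2)] S[OF that(3,4)] sign_weights.weights by metis
  have trivial: "weight_constants q (?S \<alpha> \<beta>) 1 1 \<longleftrightarrow> \<alpha> = 1 \<and> \<beta> = 1"
    if "\<alpha> \<in> {-1, 1}" "\<beta> \<in> {-1, 1}" for \<alpha> \<beta>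
    using weight_constants_unique[OF q] sign_weights.weights[OF S[OF that]] by metis
  have C1: "{\<pi> \<in> sign_symmetries q. weight_constants q \<pi> 1 1} = {?S 1 1}"
    unfolding all using trivial by auto
  have C2: "{\<pi> \<in> sign_symmetries q. \<not> weight_constants q \<pi> 1 1} = {?S 1 (-1), ?S (-1) 1, ?S (-1) (-1)}"
    unfolding all using trivial by auto
  have image: "\<exists>\<alpha>'\<in>{-1, 1}. \<exists>\<beta>'\<in>{-1, 1}. \<pi> = ?S \<alpha>' \<beta>' \<and> (\<alpha>' = 1 \<and> \<beta>' = 1 \<longleftrightarrow> \<alpha> = 1 \<and> \<beta> = 1)"
    if signs: "\<alpha> \<in> {-1, 1}" "\<beta> \<in> {-1, 1}" and iso: "(?S \<alpha> \<beta>, \<pi>) \<in> symmetry_iso q" for \<alpha> \<beta> \<pi>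
  proof -
    obtain \<alpha>' \<beta>' where *: "\<alpha>' \<in> {-1, 1}" "\<beta>' \<in> {-1, 1}" "sign_weights q \<pi> \<alpha>' \<beta>'"
      "\<alpha>' = 1 \<and> \<beta>' = 1 \<longleftrightarrow> \<alpha> = 1 \<and> \<beta> = 1"
      by (rule symmetry_iso_sign_weights[OF S[OF signs] signs iso])
    from *(3) have "\<pi> = ?S \<alpha>' \<beta>'" unfolding eq[OF *(1,2)] .
    with *(1,2,4) show ?thesis by (intro bexI[of _ \<alpha>'] bexI[of _ \<beta>'] conjI)
  qed
  have refl: "(?S \<alpha> \<beta>, ?S \<alpha> \<beta>) \<in> symmetry_iso q" if "\<alpha> \<in> {-1, 1}" "\<beta> \<in> {-1, 1}" for \<alpha> \<beta>
    using symmetry_iso_refl sign_weights.symmetry[OF S[OF that]] by blast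
  \<comment> \<open>the three isomorphisms close up to a cycle, so transitivity yields all the others\<close>
  have cyc: "(?S (-1) 1, ?S (-1) (-1)) \<in> symmetry_iso q"
    "(?S (-1) (-1), ?S 1 (-1)) \<in> symmetry_iso q"
    "(?S 1 (-1), ?S (-1) 1) \<in> symmetry_iso q"
    using sign_symmetry_iso_cycle[OF q q4, of "-1" 1] sign_symmetry_iso_cycle[OF q q4, of "-1" "-1"]
      sign_symmetry_iso_cycle[OF q q4, of 1 "-1"] by simp_all
  note cyc2 = symmetry_iso_trans[OF cyc(1,2)] symmetry_iso_trans[OF cyc(2,3)] symmetry_iso_trans[OF cyc(3,1)]
  have I1: "symmetry_iso q `` {?S 1 1} = {?S 1 1}"
    using image[of 1 1] refl[of 1 1] by fastforce
  have I2: "symmetry_iso q `` {?S \<alpha> \<beta>} = {?S 1 (-1), ?S (-1) 1, ?S (-1) (-1)}"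
    if "(\<alpha>, \<beta>) \<in> {(1, -1), (-1, 1), (-1, -1)}" for \<alpha> \<beta>
  proof
    show "symmetry_iso q `` {?S \<alpha> \<beta>} \<subseteq> {?S 1 (-1), ?S (-1) 1, ?S (-1) (-1)}"
      using image[of \<alpha> \<beta>] that by fastforce
    show "{?S 1 (-1), ?S (-1) 1, ?S (-1) (-1)} \<subseteq> symmetry_iso q `` {?S \<alpha> \<beta>}"
      using that cyc cyc2 refl by auto
  qed
  have quot: "sign_symmetries q // symmetry_iso q =
      {{?S 1 1}, {?S 1 (-1), ?S (-1) 1, ?S (-1) (-1)}}"
    unfolding all quotient_def by (simp add: I1 I2) (rule insert_commute)
  have ne: "?S 1 1 \<noteq> ?S 1 (-1)" "?S 1 1 \<noteq> ?S (-1) 1" "?S 1 1 \<noteq> ?S (-1) (-1)"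
    "?S 1 (-1) \<noteq> ?S (-1) 1" "?S 1 (-1) \<noteq> ?S (-1) (-1)" "?S (-1) 1 \<noteq> ?S (-1) (-1)"
    by (simp_all add: inj)
  have card_all: "card (sign_symmetries q) = 4" unfolding all using ne by simp
  have card_quot: "card (sign_symmetries q // symmetry_iso q) = 2" unfolding quot using ne by simp
  have card_C2: "card {?S 1 (-1), ?S (-1) 1, ?S (-1) (-1)} = 3" using ne by simp
  show ?thesis
    unfolding C1 C2
    by (intro conjI 1 2 card_all quot card_quot card_C2) simp
qed

end
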